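(* The positive unit ball $B_X^+$ of the binary tree space $X=X_T$ is not an SCD set. In particular, $X$ is a Banach space which fails to be SCD, but contains no isomorphic copy of a Banach space with the Daugavet property.
   Context: Binary tree space: $T=\{\emptyset\}\cup\bigcup_{n\in\mathbb{N}}\{0,1\}^n$ is the infinite binary tree of finite $0$-$1$ sequences, ordered by $s\preceq t$ iff $s$ is an initial segment of $t$. A chain is a non-empty (totally, hence well) ordered subset of $T$; $\mathcal{A}$ is the collection of all chains. $X=X_T$ is the real Banach space obtained by completing the space $c_{00}(T)$ of finitely supported real functions on $T$ for the norm $\|x\|=\sup_{A\in\mathcal{A}}\sum_{t\in A}|x(t)|$. The family $(e_t)_{t\in T}$ of unit vectors is a 1-unconditional basis of $X$, and elements of $X$ are identified with their coordinate functions $x=(x(t))_{t\in T}$. $B_X$ is the closed unit ball and $B_X^+=\{x\in B_X\colon x(t)\geq 0\ \forall t\in T\}$. SCD: Let $A$ be a bounded non-empty subset of a real Banach space $Z$. A slice of $A$ is a set $S(A,f,\delta)=\{x\in A\colon f(x)>\sup f(A)-\delta\}$ with $f\in Z^*$, $\delta>0$. A collection $\{A_i\}_{i\in I}$ of non-empty subsets of $A$ is determining for $A$ if $A\subseteq\overline{\mathrm{conv}}\{x_i\colon i\in I\}$ for every $(x_i)_{i\in I}\in\prod_{i\in I}A_i$. The set $A$ is slicely countably determined (an SCD set) if it admits a countable determining collection of slices. A separable Banach space is slicely countably determined (an SCD space) if all its bounded non-empty subsets are SCD sets. A (nonzero) Banach space $Z$ has the Daugavet property if every rank 1 bounded operator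 $R\colon Z\to Z$ satisfies $\|\mathrm{Id}+R\|=1+\|R\|$. *)

theory Defs
  imports "HOL-Analysis.Analysis" "HOL-Library.Sublist"
begin

section \<open>The norm on functions on the binary tree\<close>

text \<open>
  The infinite binary tree is the type \<^typ>\<open>bool list\<close>, ordered by \<^const>\<open>prefix\<close>; its root is
  the empty list.
\<close>

definition tree_chains :: "bool list set set" where
  "tree_chains = {A. A \<noteq> {} \<and> Complete_Partial_Order.chain prefix A}"

definition tree_norm :: "(bool list \<Rightarrow> real) \<Rightarrow> real" where
  "tree_norm x = (SUP A\<in>tree_chains. \<Sum>\<^sub>\<infinity>t\<in>A. \<bar>x t\<bar>)"

text \<open>
  The inequality \<open>tree_norm x \<le> c\<close>, stated without relying on the default values that infinite
  sums and suprema take when they do not exist.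
\<close>

definition tree_norm_le :: "(bool list \<Rightarrow> real) \<Rightarrow> real \<Rightarrow> bool" where
  "tree_norm_le x c \<longleftrightarrow>
     (\<forall>A\<in>tree_chains. (\<lambda>t. \<bar>x t\<bar>) summable_on A \<and> (\<Sum>\<^sub>\<infinity>t\<in>A. \<bar>x t\<bar>) \<le> c)"

lemma singleton_tree_chains: "{t} \<in> tree_chains"
  by (auto simp: tree_chains_def Complete_Partial_Order.chain_def)

lemma subset_tree_chains: "A \<in> tree_chains \<Longrightarrow> F \<subseteq> A \<Longrightarrow> F \<noteq> {} \<Longrightarrow> F \<in> tree_chains"
  by (auto simp: tree_chains_def Complete_Partial_Order.chain_def)

lemma tree_norm_le_iff:
  "tree_norm_le x c \<longleftrightarrow> (\<forall>F\<in>tree_chains. finite F \<longrightarrow> (\<Sum>t\<in>F. \<bar>x t\<bar>) \<le> c)"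
proof
  assume "tree_norm_le x c"
  then show "\<forall>F\<in>tree_chains. finite F \<longrightarrow> (\<Sum>t\<in>F. \<bar>x t\<bar>) \<le> c"
    unfolding tree_norm_le_def by (metis infsum_finite)
next
  assume *: "\<forall>F\<in>tree_chains. finite F \<longrightarrow> (\<Sum>t\<in>F. \<bar>x t\<bar>) \<le> c"
  have c0: "0 \<le> c"
    using *[rule_format, OF singleton_tree_chains[of "[]"]] by simp
  have le: "(\<Sum>t\<in>F. \<bar>x t\<bar>) \<le> c" if "A \<in> tree_chains" "F \<subseteq> A" "finite F" for A F
    using * subset_tree_chains[OF that(1,2)] that(3) c0 by (cases "F = {}") auto
  show "tree_norm_le x c"
    unfolding tree_norm_le_def
  proof (intro ballI conjI)
    fix A assume A: "A \<in> tree_chains"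
    show s: "(\<lambda>t. \<bar>x t\<bar>) summable_on A"
      by (rule nonneg_bdd_above_summable_on) (auto intro!: bdd_aboveI2[where M=c] le[OF A])
    show "(\<Sum>\<^sub>\<infinity>t\<in>A. \<bar>x t\<bar>) \<le> c"
      by (rule infsum_le_finite_sums[OF s]) (auto intro: le[OF A])
  qed
qed

lemma tree_norm_le_iff_tree_norm:
  assumes "tree_norm_le x d"
  shows "tree_norm_le x c \<longleftrightarrow> tree_norm x \<le> c"
proof -
  have ne: "tree_chains \<noteq> {}"
    using singleton_tree_chains by blast
  have "bdd_above ((\<lambda>A. \<Sum>\<^sub>\<infinity>t\<in>A. \<bar>x t\<bar>) ` tree_chains)"
    using assms by (intro bdd_aboveI2[where M=d]) (auto simp: tree_norm_le_def)
  then show ?thesis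
    using assms unfolding tree_norm_le_def tree_norm_def by (subst cSUP_le_iff[OF ne]) auto
qed

lemma tree_norm_le_coord:
  assumes "tree_norm_le x c" shows "\<bar>x t\<bar> \<le> c"
  using assms singleton_tree_chains[of t] by (force simp: tree_norm_le_iff)

lemma tree_norm_le_add:
  assumes "tree_norm_le x c" "tree_norm_le y d"
  shows "tree_norm_le (\<lambda>t. x t + y t) (c + d)"
  unfolding tree_norm_le_iff
proof (intro ballI impI)
  fix F assume F: "F \<in> tree_chains" "finite F"
  have "(\<Sum>t\<in>F. \<bar>x t + y t\<bar>) \<le> (\<Sum>t\<in>F. \<bar>x t\<bar> + \<bar>y t\<bar>)"
    by (intro sum_mono) auto
  also have "\<dots> \<le> c + d"
    using assms F by (auto simp: sum.distrib tree_norm_le_iff intro!: add_mono)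
  finally show "(\<Sum>t\<in>F. \<bar>x t + y t\<bar>) \<le> c + d" .
qed

lemma tree_norm_le_scale:
  assumes "tree_norm_le x c"
  shows "tree_norm_le (\<lambda>t. a * x t) (\<bar>a\<bar> * c)"
  using assms
  by (auto simp: tree_norm_le_iff abs_mult mult_left_mono simp flip: sum_distrib_left)

lemma tree_norm_le_minus: "tree_norm_le x c \<Longrightarrow> tree_norm_le (\<lambda>t. - x t) c"
  using tree_norm_le_scale[of x c "-1"] by simp

lemma tree_norm_le_mono: "tree_norm_le x c \<Longrightarrow> c \<le> d \<Longrightarrow> tree_norm_le x d"
  by (force simp: tree_norm_le_iff)

lemma tree_norm_le_zero: "tree_norm_le (\<lambda>t. 0) 0"
  by (simp add: tree_norm_le_iff)

lemma finite_support_tree_norm_le: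
  assumes "finite {t. y t \<noteq> 0}"
  shows "tree_norm_le y (\<Sum>t\<in>{t. y t \<noteq> 0}. \<bar>y t\<bar>)"
  unfolding tree_norm_le_iff
proof (intro ballI impI)
  fix F :: "bool list set" assume F: "finite F"
  have "(\<Sum>t\<in>F. \<bar>y t\<bar>) = (\<Sum>t\<in>F \<inter> {t. y t \<noteq> 0}. \<bar>y t\<bar>)"
    using F by (intro sum.mono_neutral_right) auto
  also have "\<dots> \<le> (\<Sum>t\<in>{t. y t \<noteq> 0}. \<bar>y t\<bar>)"
    using assms by (intro sum_mono2) auto
  finally show "(\<Sum>t\<in>F. \<bar>y t\<bar>) \<le> (\<Sum>t\<in>{t. y t \<noteq> 0}. \<bar>y t\<bar>)" .
qed


section \<open>The binary tree space\<close>

text \<open>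
  The completion of the finitely supported functions is realised by coordinate functions, as the
  set of all functions that can be approximated arbitrarily well by finitely supported ones.
  The \<open>banach\<close> instance and the lemmas \<open>finite_support_in_range_coord\<close> and \<open>closure_finite_support\<close>
  below show that this is the completion.
\<close>

typedef tree_space =
  "{x :: bool list \<Rightarrow> real.
      \<forall>\<epsilon>>0. \<exists>y. finite {t. y t \<noteq> 0} \<and> tree_norm_le (\<lambda>t. x t - y t) \<epsilon>}"
  morphisms coord Abs_tree_space
  by (rule exI[of _ "\<lambda>_. 0"])
     (auto intro!: exI[of _ "\<lambda>_. 0"] tree_norm_le_mono[OF tree_norm_le_zero])

lemma coord_approx:
  assumes "\<epsilon> > 0"
  obtains y where "finite {t. y t \<noteq> 0}" "tree_norm_le (\<lambda>t. coord x t - y t) \<epsilon>"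
  using coord[of x] assms by auto

lemma coord_Abs:
  assumes "\<And>\<epsilon>. \<epsilon> > 0 \<Longrightarrow> \<exists>y. finite {t. y t \<noteq> 0} \<and> tree_norm_le (\<lambda>t. x t - y t) \<epsilon>"
  shows "coord (Abs_tree_space x) = x"
  using assms by (intro Abs_tree_space_inverse) auto

lemma finite_support_in_range_coord:
  assumes "finite {t. y t \<noteq> 0}"
  shows "y \<in> range coord"
proof -
  have "coord (Abs_tree_space y) = y"
    using assms by (intro coord_Abs)
      (auto intro!: exI[of _ y] tree_norm_le_mono[OF tree_norm_le_zero])
  then show ?thesis by (metis rangeI)
qed

lemma coord_tree_norm_le: "\<exists>c. tree_norm_le (coord x) c"
proof -
  obtain y where y: "finite {t. y t \<noteq> 0}" "tree_norm_le (\<lambda>t. coord x t - y t) 1"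
    using coord_approx[of 1 x] by auto
  show ?thesis
    using tree_norm_le_add[OF y(2) finite_support_tree_norm_le[OF y(1)]] by auto
qed

lemma tree_norm_le_coord_iff: "tree_norm_le (coord x) c \<longleftrightarrow> tree_norm (coord x) \<le> c"
  using coord_tree_norm_le tree_norm_le_iff_tree_norm by blast

instantiation tree_space :: real_normed_vector
begin

definition "0 = Abs_tree_space (\<lambda>t. 0)"
definition "x + y = Abs_tree_space (\<lambda>t. coord x t + coord y t)"
definition "- x = Abs_tree_space (\<lambda>t. - coord x t)"
definition "x - y = Abs_tree_space (\<lambda>t. coord x t - coord y t)"
definition "a *\<^sub>R x = Abs_tree_space (\<lambda>t. a * coord x t)"
definition "norm x = tree_norm (coord x)"
definition "dist x y = norm (x - y :: tree_space)"
definition "sgn x = inverse (norm x) *\<^sub>R (x :: tree_space)"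
definition "(uniformity :: (tree_space \<times> tree_space) filter) =
  (INF e\<in>{0<..}. principal {(x, y). dist x y < e})"
definition "open (U :: tree_space set) \<longleftrightarrow>
  (\<forall>x\<in>U. eventually (\<lambda>(x', y). x' = x \<longrightarrow> y \<in> U) uniformity)"

lemma coord_zero: "coord 0 = (\<lambda>t. 0)"
  unfolding zero_tree_space_def
  by (rule coord_Abs) (auto intro!: exI[of _ "\<lambda>_. 0"] tree_norm_le_mono[OF tree_norm_le_zero])

lemma coord_add: "coord (x + y) = (\<lambda>t. coord x t + coord y t)"
  unfolding plus_tree_space_def
proof (rule coord_Abs)
  fix e :: real assume "e > 0"
  then have e: "e / 2 > 0" by simp
  obtain u where u: "finite {t. u t \<noteq> 0}" "tree_norm_le (\<lambda>t. coord x t - u t) (e/2)"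
    using coord_approx[OF e] by auto
  obtain v where v: "finite {t. v t \<noteq> 0}" "tree_norm_le (\<lambda>t. coord y t - v t) (e/2)"
    using coord_approx[OF e] by auto
  have "finite {t. u t + v t \<noteq> 0}"
    by (rule finite_subset[OF _ finite_UnI[OF u(1) v(1)]]) auto
  moreover have "tree_norm_le (\<lambda>t. coord x t + coord y t - (u t + v t)) e"
    using tree_norm_le_add[OF u(2) v(2)] by (simp add: algebra_simps)
  ultimately show "\<exists>w. finite {t. w t \<noteq> 0} \<and>
      tree_norm_le (\<lambda>t. coord x t + coord y t - w t) e"
    by (intro exI[of _ "\<lambda>t. u t + v t"]) auto
qed

lemma coord_scaleR: "coord (a *\<^sub>R x) = (\<lambda>t. a * coord x t)"
  unfolding scaleR_tree_space_def
proof (rule coord_Abs)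
  fix e :: real assume "e > 0"
  then have e: "e / (\<bar>a\<bar> + 1) > 0" by (simp add: add_nonneg_pos)
  obtain u where u: "finite {t. u t \<noteq> 0}" "tree_norm_le (\<lambda>t. coord x t - u t) (e / (\<bar>a\<bar> + 1))"
    using coord_approx[OF e] by auto
  have "finite {t. a * u t \<noteq> 0}"
    by (rule finite_subset[OF _ u(1)]) auto
  moreover have "\<bar>a\<bar> * (e / (\<bar>a\<bar> + 1)) \<le> e"
    using \<open>e > 0\<close> by (simp add: field_simps)
  then have "tree_norm_le (\<lambda>t. a * coord x t - a * u t) e"
    using tree_norm_le_mono[OF tree_norm_le_scale[OF u(2), of a]]
    by (simp add: algebra_simps)
  ultimately show "\<exists>w. finite {t. w t \<noteq> 0} \<and> tree_norm_le (\<lambda>t. a * coord x t - w t) e"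
    by (intro exI[of _ "\<lambda>t. a * u t"]) auto
qed

lemma coord_uminus: "coord (- x) = (\<lambda>t. - coord x t)"
  using coord_scaleR[of "-1" x] unfolding uminus_tree_space_def scaleR_tree_space_def by simp

lemma coord_minus: "coord (x - y) = (\<lambda>t. coord x t - coord y t)"
  using coord_add[of x "- y"] coord_uminus[of y]
  unfolding minus_tree_space_def plus_tree_space_def by simp

lemmas coord_simps = coord_zero coord_add coord_scaleR coord_uminus coord_minus

lemma norm_tree_space_le_iff: "norm x \<le> c \<longleftrightarrow> tree_norm_le (coord x) c"
  by (simp add: norm_tree_space_def tree_norm_le_coord_iff)

lemma abs_coord_le_norm: "\<bar>coord x t\<bar> \<le> norm x"
  using norm_tree_space_le_iff[of x "norm x"] tree_norm_le_coord by blast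

lemma norm_tree_space_scaleR_le: "norm (a *\<^sub>R x) \<le> \<bar>a\<bar> * norm (x :: tree_space)"
  using tree_norm_le_scale[of "coord x" "norm x" a] norm_tree_space_le_iff[of x "norm x"]
  by (simp add: norm_tree_space_le_iff coord_simps)

instance
proof
  fix x y z :: tree_space and a b :: real
  show "norm (x + y) \<le> norm x + norm y"
    using tree_norm_le_add norm_tree_space_le_iff[of x "norm x"] norm_tree_space_le_iff[of y "norm y"]
    by (simp add: norm_tree_space_le_iff coord_simps)
  show "norm (a *\<^sub>R x) = \<bar>a\<bar> * norm x"
  proof (rule antisym[OF norm_tree_space_scaleR_le])
    show "\<bar>a\<bar> * norm x \<le> norm (a *\<^sub>R x)"
    proof (cases "a = 0")
      case True
      then show ?thesis using abs_coord_le_norm[of "a *\<^sub>R x" "[]"] by simp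
    next
      case False
      have "inverse a *\<^sub>R a *\<^sub>R x = x"
        using False unfolding coord_inject[symmetric] coord_simps by (simp add: fun_eq_iff field_simps)
      then have "norm x \<le> \<bar>inverse a\<bar> * norm (a *\<^sub>R x)"
        using norm_tree_space_scaleR_le[of "inverse a" "a *\<^sub>R x"] by simp
      then show ?thesis
        using False by (simp add: field_simps)
    qed
  qed
  show "(norm x = 0) = (x = 0)"
  proof
    assume "norm x = 0"
    then have "coord x t = 0" for t using abs_coord_le_norm[of x t] by simp
    then show "x = 0" unfolding coord_inject[symmetric] coord_simps by blast
  next
    assume "x = 0"
    then have "norm x \<le> 0"
      by (simp add: norm_tree_space_le_iff coord_simps tree_norm_le_zero)
    then show "norm x = 0"
      using abs_coord_le_norm[of x "[]"] by simp
  qed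
  show "x + y + z = x + (y + z)" "x + y = y + x" "0 + x = x" "- x + x = 0" "x - y = x + - y"
    "a *\<^sub>R (x + y) = a *\<^sub>R x + a *\<^sub>R y" "(a + b) *\<^sub>R x = a *\<^sub>R x + b *\<^sub>R x"
    "a *\<^sub>R b *\<^sub>R x = (a * b) *\<^sub>R x" "1 *\<^sub>R x = x"
    unfolding coord_inject[symmetric] coord_simps by (simp_all add: fun_eq_iff algebra_simps)
qed (rule dist_tree_space_def sgn_tree_space_def uniformity_tree_space_def open_tree_space_def)+

end

instance tree_space :: banach
proof
  fix u :: "nat \<Rightarrow> tree_space" assume "Cauchy u"
  then have C: "\<exists>N. \<forall>m\<ge>N. \<forall>n\<ge>N. norm (u m - u n) < e" if "e > 0" for e
    using that by (simp add: Cauchy_def dist_norm)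
  have "Cauchy (\<lambda>n. coord (u n) t)" for t
    unfolding Cauchy_def dist_norm
  proof (intro allI impI)
    fix e :: real assume "e > 0"
    from C[OF this] obtain N where "\<forall>m\<ge>N. \<forall>n\<ge>N. norm (u m - u n) < e" by blast
    moreover have "norm (coord (u m) t - coord (u n) t) \<le> norm (u m - u n)" for m n
      using abs_coord_le_norm[of "u m - u n" t] by (simp add: coord_simps)
    ultimately show "\<exists>N. \<forall>m\<ge>N. \<forall>n\<ge>N. norm (coord (u m) t - coord (u n) t) < e"
      by (meson order.strict_trans1)
  qed
  then have "\<forall>t. \<exists>l. (\<lambda>n. coord (u n) t) \<longlonglongrightarrow> l"
    by (simp add: Cauchy_convergent_iff convergent_def)
  then obtain x where x: "\<And>t. (\<lambda>n. coord (u n) t) \<longlonglongrightarrow> x t"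
    by metis
  have lim: "\<exists>N. \<forall>m\<ge>N. tree_norm_le (\<lambda>t. x t - coord (u m) t) e" if e: "e > 0" for e
  proof -
    from C[OF e] obtain N where N: "\<And>m n. m \<ge> N \<Longrightarrow> n \<ge> N \<Longrightarrow> norm (u n - u m) < e" by blast
    have "tree_norm_le (\<lambda>t. x t - coord (u m) t) e" if m: "m \<ge> N" for m
      unfolding tree_norm_le_iff
    proof (intro ballI impI)
      fix F assume F: "F \<in> tree_chains" "finite F"
      show "(\<Sum>t\<in>F. \<bar>x t - coord (u m) t\<bar>) \<le> e"
      proof (rule tendsto_upperbound)
        show "(\<lambda>n. \<Sum>t\<in>F. \<bar>coord (u n) t - coord (u m) t\<bar>) \<longlonglongrightarrow> (\<Sum>t\<in>F. \<bar>x t - coord (u m) t\<bar>)"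
          by (intro tendsto_intros x)
        have "(\<Sum>t\<in>F. \<bar>coord (u n) t - coord (u m) t\<bar>) \<le> e" if "n \<ge> N" for n
          using less_imp_le[OF N[OF m that]] F
          by (simp add: norm_tree_space_le_iff coord_simps tree_norm_le_iff)
        then show "\<forall>\<^sub>F n in sequentially. (\<Sum>t\<in>F. \<bar>coord (u n) t - coord (u m) t\<bar>) \<le> e"
          by (auto simp: eventually_sequentially)
      qed auto
    qed
    then show ?thesis by blast
  qed
  have cx: "coord (Abs_tree_space x) = x"
  proof (rule coord_Abs)
    fix e :: real assume "e > 0"
    then have e: "e / 2 > 0" by simp
    obtain m where m: "tree_norm_le (\<lambda>t. x t - coord (u m) t) (e / 2)"
      using lim[OF e] by blast
    obtain y where y: "finite {t. y t \<noteq> 0}" "tree_norm_le (\<lambda>t. coord (u m) t - y t) (e / 2)"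
      using coord_approx[OF e] by blast
    have "tree_norm_le (\<lambda>t. x t - y t) e"
      using tree_norm_le_add[OF m y(2)] by simp
    with y(1) show "\<exists>y. finite {t. y t \<noteq> 0} \<and> tree_norm_le (\<lambda>t. x t - y t) e" by blast
  qed
  have "u \<longlonglongrightarrow> Abs_tree_space x"
    unfolding LIMSEQ_def
  proof (intro allI impI)
    fix e :: real assume "e > 0"
    then have e: "e / 2 > 0" by simp
    from lim[OF e] obtain N where
      "\<And>m. m \<ge> N \<Longrightarrow> tree_norm_le (\<lambda>t. x t - coord (u m) t) (e / 2)" by blast
    then have "norm (Abs_tree_space x - u m) \<le> e / 2" if "m \<ge> N" for m
      using that unfolding norm_tree_space_le_iff coord_minus cx by blast
    then show "\<exists>N. \<forall>n\<ge>N. dist (u n) (Abs_tree_space x) < e"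
      using \<open>e > 0\<close> by (intro exI[of _ N]) (force simp: dist_norm norm_minus_commute)
  qed
  then show "convergent u" by (auto simp: convergent_def)
qed

lemma closure_finite_support: "closure {x. finite {t. coord x t \<noteq> 0}} = UNIV"
proof -
  have "x \<in> closure {x. finite {t. coord x t \<noteq> 0}}" for x
    unfolding closure_approachable
  proof (intro allI impI)
    fix e :: real assume "e > 0"
    then have e: "e / 2 > 0" by simp
    obtain y where y: "finite {t. y t \<noteq> 0}" "tree_norm_le (\<lambda>t. coord x t - y t) (e / 2)"
      using coord_approx[OF e] by blast
    then obtain z where z: "y = coord z"
      using finite_support_in_range_coord by blast
    have "norm (x - z) \<le> e / 2"
      using y(2) unfolding norm_tree_space_le_iff coord_minus z .
    then have "dist z x < e"
      using \<open>e > 0\<close> by (simp add: dist_norm norm_minus_commute)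
    then show "\<exists>y\<in>{x. finite {t. coord x t \<noteq> 0}}. dist y x < e"
      using y(1) z by blast
  qed
  then show ?thesis by blast
qed

definition unit_vector :: "bool list \<Rightarrow> tree_space" where
  "unit_vector s = Abs_tree_space (\<lambda>t. if t = s then 1 else 0)"

lemma coord_unit_vector: "coord (unit_vector s) = (\<lambda>t. if t = s then 1 else 0)"
proof -
  have "(\<lambda>t. if t = s then 1 else 0) \<in> range coord"
    by (rule finite_support_in_range_coord) auto
  then show ?thesis
    unfolding unit_vector_def by (auto simp: coord_inverse)
qed

lemma coord_sum: "coord (\<Sum>s\<in>F. f s) t = (\<Sum>s\<in>F. coord (f s) t)"
  by (induction F rule: infinite_finite_induct) (auto simp: coord_simps)

lemma finite_support_expansion:
  assumes "finite {t. coord x t \<noteq> 0}"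
  shows "x = (\<Sum>s\<in>{t. coord x t \<noteq> 0}. coord x s *\<^sub>R unit_vector s)"
proof -
  have "coord (\<Sum>s\<in>{t. coord x t \<noteq> 0}. coord x s *\<^sub>R unit_vector s) t = coord x t" for t
  proof -
    have "coord (\<Sum>s\<in>{t. coord x t \<noteq> 0}. coord x s *\<^sub>R unit_vector s) t
        = (\<Sum>s\<in>{t. coord x t \<noteq> 0}. if t = s then coord x s else 0)"
      unfolding coord_sum coord_simps coord_unit_vector by (intro sum.cong) auto
    also have "\<dots> = coord x t"
      using assms by (simp add: sum.delta')
    finally show ?thesis .
  qed
  then show ?thesis unfolding coord_inject[symmetric] by (intro ext) (rule sym)
qed

lemma countable_dense_tree_space: "\<exists>D :: tree_space set. countable D \<and> closure D = UNIV"
proof -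
  define g where "g l = (\<Sum>(s, q)\<leftarrow>l. of_rat q *\<^sub>R unit_vector s)" for l :: "(bool list \<times> rat) list"
  have step: "w + a *\<^sub>R unit_vector s \<in> closure (range g)" if w: "w \<in> closure (range g)" for w a s
    unfolding closure_approachable
  proof (intro allI impI)
    fix e :: real assume e: "e > 0"
    define k where "k = norm (unit_vector s) + 1"
    have k: "k > 0" "norm (unit_vector s) \<le> k" unfolding k_def by (auto simp: add_nonneg_pos)
    obtain l where l: "dist (g l) w < e / 2"
      using w e unfolding closure_approachable by (force dest!: spec[of _ "e / 2"])
    have "a - e / (2 * k) < a" using e k by simp
    then obtain q where q: "a - e / (2 * k) < of_rat q" "of_rat q < a"
      using of_rat_dense by blast
    have "norm ((of_rat q - a) *\<^sub>R unit_vector s) \<le> e / (2 * k) * k"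
      using q k e unfolding norm_scaleR by (intro mult_mono) auto
    then have "norm ((of_rat q - a) *\<^sub>R unit_vector s) \<le> e / 2"
      using k by simp
    moreover have "g ((s, q) # l) - (w + a *\<^sub>R unit_vector s)
        = (g l - w) + (of_rat q - a) *\<^sub>R unit_vector s"
      by (simp add: g_def algebra_simps)
    moreover have "norm (g l - w) < e / 2"
      using l by (simp only: dist_norm)
    ultimately have "norm (g ((s, q) # l) - (w + a *\<^sub>R unit_vector s)) < e"
      by (simp only:) (rule norm_triangle_lt, linarith)
    then show "\<exists>y\<in>range g. dist y (w + a *\<^sub>R unit_vector s) < e"
      by (metis dist_norm rangeI)
  qed
  have "0 = g []" by (simp add: g_def)
  then have zero: "0 \<in> closure (range g)"
    by (metis closure_subset rangeI subsetD)
  have comb: "(\<Sum>s\<in>F. c s *\<^sub>R unit_vector s) \<in> closure (range g)" if "finite F" for F c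
    using that
  proof (induction F rule: finite_induct)
    case empty
    then show ?case using zero by simp
  next
    case (insert s F)
    then show ?case using step[of "\<Sum>s\<in>F. c s *\<^sub>R unit_vector s" "c s" s] by (simp add: add.commute)
  qed
  have "{x. finite {t. coord x t \<noteq> 0}} \<subseteq> closure (range g)"
  proof
    fix x assume "x \<in> {x. finite {t. coord x t \<noteq> 0}}"
    then have fin: "finite {t. coord x t \<noteq> 0}" by simp
    show "x \<in> closure (range g)"
      by (subst finite_support_expansion[OF fin]) (rule comb[OF fin])
  qed
  from closure_mono[OF this] have "closure (range g) = UNIV"
    unfolding closure_finite_support closure_closure by blast
  moreover have "countable (range g)" by simp
  ultimately show ?thesis by blast
qed

instance tree_space :: second_countable_topology
proof
  obtain D :: "tree_space set" where D: "countable D" "closure D = UNIV"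
    using countable_dense_tree_space by blast
  define B where "B = (\<lambda>(d, q). ball d (of_rat q)) ` (D \<times> (UNIV :: rat set))"
  have "topological_basis B"
  proof (rule topological_basisI)
    show "open U" if "U \<in> B" for U
      using that by (auto simp: B_def)
  next
    fix U and x :: tree_space assume U: "open U" "x \<in> U"
    then obtain e where e: "e > 0" "ball x e \<subseteq> U"
      using open_contains_ball by blast
    obtain q where q: "0 < real_of_rat q" "real_of_rat q < e / 2"
      using of_rat_dense[of 0 "e / 2"] e by auto
    obtain d where d: "d \<in> D" "dist d x < of_rat q"
      using D(2) q(1) closure_approachable by (metis UNIV_I)
    have "ball d (of_rat q) \<subseteq> U"
    proof
      fix z assume "z \<in> ball d (of_rat q)"
      then have "dist x z < e"
        using d(2) q(2) dist_triangle[of x z d] by (simp add: dist_commute)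
      then show "z \<in> U" using e by auto
    qed
    moreover have "x \<in> ball d (of_rat q)" using d by simp
    moreover have "ball d (of_rat q) \<in> B" using d by (auto simp: B_def)
    ultimately show "\<exists>V\<in>B. x \<in> V \<and> V \<subseteq> U" by blast
  qed
  moreover have "countable B"
    unfolding B_def using D by simp
  ultimately show "\<exists>B :: tree_space set set. countable B \<and> open = generate_topology B"
    using topological_basis_imp_subbasis by blast
qed

definition positive_unit_ball :: "tree_space set" where
  "positive_unit_ball = {x \<in> cball 0 1. \<forall>t. coord x t \<ge> 0}"


section \<open>Slicely countably determined sets and spaces\<close>

definition slice :: "'a::banach set \<Rightarrow> ('a \<Rightarrow>\<^sub>L real) \<Rightarrow> real \<Rightarrow> 'a set" where
  "slice A f \<delta> = {x \<in> A. blinfun_apply f x > (SUP a\<in>A. blinfun_apply f a) - \<delta>}"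

definition is_slice :: "'a::banach set \<Rightarrow> 'a set \<Rightarrow> bool" where
  "is_slice A S \<longleftrightarrow> (\<exists>f \<delta>. \<delta> > 0 \<and> S = slice A f \<delta>)"

definition determining :: "'a::banach set \<Rightarrow> 'i set \<Rightarrow> ('i \<Rightarrow> 'a set) \<Rightarrow> bool" where
  "determining A I S \<longleftrightarrow>
     (\<forall>i\<in>I. S i \<noteq> {} \<and> S i \<subseteq> A) \<and> (\<forall>x\<in>Pi I S. A \<subseteq> closure (convex hull (x ` I)))"

text \<open>
  Countable families are indexed by subsets of \<^typ>\<open>nat\<close>. The notion is meant for bounded
  non-empty \<open>A\<close>; otherwise the supremum in \<^const>\<open>slice\<close> need not exist.
\<close>

definition SCD_set :: "'a::banach set \<Rightarrow> bool" where
  "SCD_set A \<longleftrightarrow>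
     (\<exists>(I :: nat set) S. (\<forall>i\<in>I. is_slice A (S i)) \<and> determining A I S)"

text \<open>The class \<open>second_countable_topology\<close> expresses separability.\<close>

definition SCD_space :: "'a::{banach, second_countable_topology} itself \<Rightarrow> bool" where
  "SCD_space _ \<longleftrightarrow> (\<forall>A :: 'a set. bounded A \<and> A \<noteq> {} \<longrightarrow> SCD_set A)"


section \<open>The Daugavet property and isomorphic copies\<close>

definition Daugavet_property :: "'z::banach itself \<Rightarrow> bool" where
  "Daugavet_property _ \<longleftrightarrow>
     (\<exists>z :: 'z. z \<noteq> 0) \<and>
     (\<forall>R :: 'z \<Rightarrow>\<^sub>L 'z. dim (range (blinfun_apply R)) = 1 \<longrightarrow>
        norm (id_blinfun + R) = 1 + norm R)"

definition contains_isomorphic_copy :: "'x::banach itself \<Rightarrow> 'z::banach itself \<Rightarrow> bool" where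
  "contains_isomorphic_copy _ _ \<longleftrightarrow>
     (\<exists>(Y :: 'x set) (f :: 'z \<Rightarrow> 'x) g.
        subspace Y \<and> closed Y \<and> linear f \<and> homeomorphism UNIV Y f g)"

end

theory Submission
  imports Defs
begin

text \<open>
  \<^emph>\<open>The positive unit ball.\<close> Given countably many slices, a point of each is chosen so that a
  single branch functional, the sum of all coordinates along one infinite chain, is at least \<open>1\<close>
  at every chosen point. It is then at least \<open>1\<close> on the convex hull, so that no vector of the
  closed hull has norm less than \<open>1\<close>, and the closed hull misses the point \<open>0\<close> of the ball. To find the points,
  note that the coordinates of a functional \<open>f\<close> along an infinite antichain are small somewhere,
  because the unit vectors along an antichain span a copy of \<open>c\<^sub>0\<close>. Hence, from a finitely supported
  member \<open>x\<close> of a slice of \<open>f\<close> and the initial part of the chain built so far, that part can be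
  extended to a node \<open>s'\<close> beyond the support of \<open>x\<close> where \<open>f\<close> is nearly zero. The mass that \<open>x\<close> lacks
  on the path from the root to \<open>s'\<close> can be put on \<open>s'\<close> without leaving the slice or the ball
  (\<open>slice_point_full_below_node\<close>).

  \<^emph>\<open>The Daugavet property.\<close> If \<open>Z\<close> has it, then every slice of the unit ball of \<open>Z\<close> contains, for
  each \<open>w\<close>, a vector \<open>y\<close> with \<open>\<parallel>w + y\<parallel> \<approx> \<parallel>w\<parallel> + 1\<close> (\<open>Daugavet_slice\<close>), and so does every relative weak
  neighbourhood of a point of the ball (\<open>Daugavet_near_point\<close>). Let \<open>T\<close> embed \<open>Z\<close> into the tree
  space. Vectors \<open>y\<^sub>0 = 0, y\<^sub>1, y\<^sub>2, \<dots>\<close> of the ball of \<open>Z\<close> are chosen so that \<open>y\<^sub>k\<^sub>+\<^sub>1\<close> is weakly near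
  \<open>- y\<^sub>k\<close> and the norm of \<open>w\<^sub>k = y\<^sub>0 + \<dots> + y\<^sub>k\<close> grows linearly. Then
  \<open>v\<^sub>k\<^sub>+\<^sub>1 = T (y\<^sub>k\<^sub>+\<^sub>1 + y\<^sub>k)\<close> nearly vanishes on the finite set of coordinates that matters for the
  earlier vectors, so the \<open>v\<^sub>i\<close> are nearly disjoint blocks. Now
  \<open>T y\<^sub>k = v\<^sub>k - v\<^sub>k\<^sub>-\<^sub>1 + v\<^sub>k\<^sub>-\<^sub>2 - \<dots>\<close> is bounded, whereas
  \<open>T (2 w\<^sub>k - y\<^sub>k) = v\<^sub>1 + \<dots> + v\<^sub>k\<close> has norm of order \<open>k\<close>. The two differ only by signs of coordinates,
  which the norm of the tree space ignores: a contradiction.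
\<close>

section \<open>The positive unit ball is not slicely countably determined\<close>

lemma tree_norm_le_dominated:
  assumes "tree_norm_le x c" "\<And>t. \<bar>y t\<bar> \<le> \<bar>x t\<bar>"
  shows "tree_norm_le y c"
  unfolding tree_norm_le_iff
proof (intro ballI impI)
  fix F assume F: "F \<in> tree_chains" "finite F"
  have "(\<Sum>t\<in>F. \<bar>y t\<bar>) \<le> (\<Sum>t\<in>F. \<bar>x t\<bar>)"
    by (rule sum_mono) (rule assms(2))
  also have "\<dots> \<le> c"
    using assms(1) F by (simp add: tree_norm_le_iff)
  finally show "(\<Sum>t\<in>F. \<bar>y t\<bar>) \<le> c" .
qed

lemma coord_small_off_finite:
  assumes "\<epsilon> > 0"
  obtains A where "finite A" "tree_norm_le (\<lambda>t. if t \<in> A then 0 else coord x t) \<epsilon>"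
proof -
  obtain u where u: "finite {t. u t \<noteq> 0}" "tree_norm_le (\<lambda>t. coord x t - u t) \<epsilon>"
    using coord_approx[OF assms] by blast
  show ?thesis
    by (rule that[OF u(1)], rule tree_norm_le_dominated[OF u(2)]) auto
qed

text \<open>
  A chain meets an antichain in at most one node, so along an antichain the unit vectors behave
  like the basis of \<open>c\<^sub>0\<close>.
\<close>

lemma norm_antichain_combination_le_1:
  assumes K: "finite K"
    and anti: "\<And>i j. i \<in> K \<Longrightarrow> j \<in> K \<Longrightarrow> prefix (t i) (t j) \<Longrightarrow> i = j"
    and c: "\<And>i. i \<in> K \<Longrightarrow> \<bar>c i\<bar> \<le> 1"
  shows "norm (\<Sum>i\<in>K. c i *\<^sub>R unit_vector (t i)) \<le> 1"
  unfolding norm_tree_space_le_iff tree_norm_le_iff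
proof (intro ballI impI)
  fix F assume F: "F \<in> tree_chains" "finite F"
  have "(\<Sum>u\<in>F. \<bar>coord (\<Sum>i\<in>K. c i *\<^sub>R unit_vector (t i)) u\<bar>)
      \<le> (\<Sum>u\<in>F. \<Sum>i\<in>K. if t i = u then 1 else 0)"
    unfolding coord_sum coord_simps coord_unit_vector
    by (intro sum_mono order_trans[OF sum_abs] sum_mono) (use c in auto)
  also have "\<dots> = (\<Sum>i\<in>K. \<Sum>u\<in>F. if t i = u then 1 else 0)"
    by (rule sum.swap)
  also have "\<dots> = (\<Sum>i\<in>K. if t i \<in> F then 1 else 0)"
    using F by simp
  also have "\<dots> = real (card {i \<in> K. t i \<in> F})"
    using K by (simp add: sum.If_cases Int_def)
  also have "card {i \<in> K. t i \<in> F} \<le> Suc 0"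
    using K F(1) anti
    by (subst card_le_Suc0_iff_eq) (auto simp: tree_chains_def Complete_Partial_Order.chain_def, metis)
  then have "real (card {i \<in> K. t i \<in> F}) \<le> 1" by simp
  finally show "(\<Sum>u\<in>F. \<bar>coord (\<Sum>i\<in>K. c i *\<^sub>R unit_vector (t i)) u\<bar>) \<le> 1" .
qed

text \<open>
  Otherwise \<open>f\<close> would be unbounded on the signed sums of unit vectors along the antichain, all of
  which lie in the unit ball.
\<close>

lemma functional_small_on_antichain:
  fixes f :: "tree_space \<Rightarrow>\<^sub>L real" and t :: "nat \<Rightarrow> bool list"
  assumes "\<delta> > 0" and anti: "\<And>i j. prefix (t i) (t j) \<Longrightarrow> i = j"
  obtains k where "\<bar>blinfun_apply f (unit_vector (t k))\<bar> < \<delta>"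
proof (rule ccontr)
  assume "\<not> thesis"
  with that have ge: "\<bar>blinfun_apply f (unit_vector (t k))\<bar> \<ge> \<delta>" for k
    by (meson not_less)
  obtain m :: nat where m: "norm f < m * \<delta>"
    using reals_Archimedean3[OF assms(1)] by blast
  define x where "x = (\<Sum>k<m. sgn (blinfun_apply f (unit_vector (t k))) *\<^sub>R unit_vector (t k))"
  have "norm x \<le> 1"
    unfolding x_def by (rule norm_antichain_combination_le_1) (auto simp: anti sgn_if)
  have "m * \<delta> = (\<Sum>k<m. \<delta>)" by simp
  also have "\<dots> \<le> (\<Sum>k<m. \<bar>blinfun_apply f (unit_vector (t k))\<bar>)"
    by (intro sum_mono ge)
  also have "\<dots> = blinfun_apply f x"
    unfolding x_def blinfun.sum_right blinfun.scaleR_right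
    by (intro sum.cong) (auto simp: abs_sgn mult.commute)
  also have "\<dots> \<le> norm f * norm x"
    using norm_blinfun[of f x] by simp
  also have "\<dots> \<le> norm f"
    using \<open>norm x \<le> 1\<close> by (simp add: mult_left_le)
  finally show False using m by simp
qed

lemma prefix_replicate_True_False:
  "prefix (replicate i True @ [False]) (replicate j True @ [False]) \<Longrightarrow> i = j"
proof (induction i arbitrary: j)
  case 0
  then show ?case by (cases j) auto
next
  case (Suc i)
  show ?case
  proof (cases j)
    case 0
    then show ?thesis using Suc.prems by simp
  next
    case (Suc k)
    then have "prefix (replicate i True @ [False]) (replicate k True @ [False])"
      using Suc.prems by (simp del: prefix_snoc)
    from Suc.IH[OF this] show ?thesis using Suc by simp
  qed
qed

text \<open>
  Above any node there is an infinite antichain, the teeth of a comb: follow \<open>True\<close> for some time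
  and then turn off to \<open>False\<close>.
\<close>

lemma functional_small_above_node:
  fixes f :: "tree_space \<Rightarrow>\<^sub>L real"
  assumes "\<delta> > 0"
  obtains s' where "prefix s s'" "length s' > N" "\<bar>blinfun_apply f (unit_vector s')\<bar> < \<delta>"
proof -
  have "i = j"
    if "prefix (s @ replicate (N + i) True @ [False]) (s @ replicate (N + j) True @ [False])" for i j
    using prefix_replicate_True_False[of "N + i" "N + j"] that by simp
  then obtain k where
    "\<bar>blinfun_apply f (unit_vector (s @ replicate (N + k) True @ [False]))\<bar> < \<delta>"
    by (rule functional_small_on_antichain[OF assms])
  then show ?thesis
    by (rule that[rotated 2]) auto
qed

lemma positive_unit_ball_iff:
  "x \<in> positive_unit_ball \<longleftrightarrow> norm x \<le> 1 \<and> (\<forall>t. coord x t \<ge> 0)"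
  by (auto simp: positive_unit_ball_def)

text \<open>
  Setting all but finitely many coordinates to \<open>0\<close> keeps a vector in the positive unit ball and
  moves it as little as desired. The set \<open>{x. \<alpha> < f x}\<close> stands for the half-space that cuts out a
  slice.
\<close>

lemma finite_support_in_slice:
  fixes f :: "tree_space \<Rightarrow>\<^sub>L real"
  assumes x: "x \<in> positive_unit_ball" and less: "\<alpha> < blinfun_apply f x"
  obtains x' where "x' \<in> positive_unit_ball" "\<alpha> < blinfun_apply f x'" "finite {t. coord x' t \<noteq> 0}"
proof -
  define \<epsilon> where "\<epsilon> = (blinfun_apply f x - \<alpha>) / (norm f + 1)"
  have nf: "norm f + 1 > 0" by (simp add: add_nonneg_pos)
  have \<epsilon>: "\<epsilon> > 0" using less nf by (simp add: \<epsilon>_def)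
  obtain A where A: "finite A" "tree_norm_le (\<lambda>t. if t \<in> A then 0 else coord x t) \<epsilon>"
    using coord_small_off_finite[OF \<epsilon>] by blast
  have "(\<lambda>t. if t \<in> A then coord x t else 0) \<in> range coord"
    by (rule finite_support_in_range_coord, rule finite_subset[OF _ A(1)]) auto
  then obtain x' where x': "coord x' = (\<lambda>t. if t \<in> A then coord x t else 0)"
    by (metis imageE)
  have "tree_norm_le (coord x') 1"
    by (rule tree_norm_le_dominated[of "coord x"])
      (use x in \<open>auto simp: x' positive_unit_ball_iff norm_tree_space_le_iff\<close>)
  then have 1: "x' \<in> positive_unit_ball"
    using x by (auto simp: x' positive_unit_ball_iff norm_tree_space_le_iff)
  have "coord (x - x') = (\<lambda>t. if t \<in> A then 0 else coord x t)"
    by (auto simp: coord_simps x')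
  with A(2) have "norm (x - x') \<le> \<epsilon>"
    by (simp add: norm_tree_space_le_iff)
  then have "blinfun_apply f (x - x') \<le> norm f * \<epsilon>"
    using norm_blinfun[of f "x - x'"] by (smt (verit) mult_left_mono norm_ge_zero real_norm_def)
  also have "\<dots> < (norm f + 1) * \<epsilon>"
    using \<epsilon> by (simp add: algebra_simps)
  also have "\<dots> = blinfun_apply f x - \<alpha>"
    using nf by (simp add: \<epsilon>_def)
  finally have 2: "\<alpha> < blinfun_apply f x'"
    by (simp add: blinfun.diff_right)
  have "finite {t. coord x' t \<noteq> 0}"
    by (rule finite_subset[OF _ A(1)]) (auto simp: x')
  with 1 2 show ?thesis by (rule that)
qed

lemma chain_prefixes: "set (prefixes s) \<in> tree_chains"
  by (auto simp: tree_chains_def Complete_Partial_Order.chain_def, metis prefix_same_cases)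

lemma sum_prefixes_le_1:
  assumes "x \<in> positive_unit_ball"
  shows "(\<Sum>t\<in>set (prefixes s). coord x t) \<le> 1"
proof -
  have "(\<Sum>t\<in>set (prefixes s). \<bar>coord x t\<bar>) \<le> 1"
    using assms chain_prefixes
    by (auto simp: positive_unit_ball_iff norm_tree_space_le_iff tree_norm_le_iff)
  then show ?thesis using assms by (simp add: positive_unit_ball_iff)
qed

text \<open>
  The step that extends the chain. The mass \<open>a\<close> missing on the path to \<open>s'\<close> is added at \<open>s'\<close>. A
  chain through \<open>s'\<close> sees only that path, since \<open>s'\<close> lies beyond the support, so the norm stays at
  most \<open>1\<close>; and \<open>f\<close> changes by at most \<open>\<bar>f (unit_vector s')\<bar>\<close>, so the slice is not left.
\<close>

lemma slice_point_full_below_node: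
  fixes f :: "tree_space \<Rightarrow>\<^sub>L real"
  assumes "x \<in> positive_unit_ball" "\<alpha> < blinfun_apply f x"
  obtains s' y where "prefix s s'" "y \<in> positive_unit_ball" "\<alpha> < blinfun_apply f y"
    "(\<Sum>t\<in>set (prefixes s'). coord y t) \<ge> 1"
proof -
  obtain x' where x': "x' \<in> positive_unit_ball" "\<alpha> < blinfun_apply f x'"
      "finite {t. coord x' t \<noteq> 0}"
    using finite_support_in_slice[OF assms] by blast
  have nn: "coord x' t \<ge> 0" for t using x'(1) by (simp add: positive_unit_ball_iff)
  define N where "N = Max (insert 0 (length ` {t. coord x' t \<noteq> 0}))"
  have "length t \<le> N" if "coord x' t \<noteq> 0" for t
    unfolding N_def using x'(3) that by (intro Max_ge) auto
  then have N: "coord x' t = 0" if "length t > N" for t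
    using that by (meson leD)
  obtain s' where s': "prefix s s'" "length s' > N"
      "\<bar>blinfun_apply f (unit_vector s')\<bar> < blinfun_apply f x' - \<alpha>"
    using functional_small_above_node[of "blinfun_apply f x' - \<alpha>" s N f] x'(2) by auto
  define a where "a = 1 - (\<Sum>t\<in>set (prefixes s'). coord x' t)"
  have a: "0 \<le> a" "a \<le> 1"
    using sum_prefixes_le_1[OF x'(1), of s'] sum_nonneg[of "set (prefixes s')" "coord x'"] nn
    by (auto simp: a_def)
  define y where "y = x' + a *\<^sub>R unit_vector s'"
  have y: "coord y t = coord x' t + (if t = s' then a else 0)" for t
    by (simp add: y_def coord_simps coord_unit_vector)
  have y_nn: "coord y t \<ge> 0" for t
    using a nn by (simp add: y)
  have full: "(\<Sum>t\<in>set (prefixes s'). coord y t) = 1"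
    by (simp add: y sum.distrib a_def)
  have "tree_norm_le (coord y) 1"
    unfolding tree_norm_le_iff
  proof (intro ballI impI)
    fix F assume F: "F \<in> tree_chains" "finite F"
    show "(\<Sum>t\<in>F. \<bar>coord y t\<bar>) \<le> 1"
    proof (cases "s' \<in> F")
      case True
      (* Members of F above s' lie beyond the support of y, so the rest lies below s'. *)
      have "coord y t = 0" if "t \<in> F" "t \<notin> set (prefixes s')" for t
      proof -
        have "prefix s' t"
          using that F(1) True
          by (auto simp: tree_chains_def Complete_Partial_Order.chain_def in_set_prefixes)
        then have "length t > N" "t \<noteq> s'"
          using s'(2) that(2) prefix_length_le[of s' t] by auto
        then show ?thesis using N y by simp
      qed
      then have "(\<Sum>t\<in>F. \<bar>coord y t\<bar>) = (\<Sum>t\<in>F \<inter> set (prefixes s'). coord y t)"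
        using F(2) y_nn by (intro sum.mono_neutral_cong_right) auto
      also have "\<dots> \<le> (\<Sum>t\<in>set (prefixes s'). coord y t)"
        using y_nn by (intro sum_mono2) auto
      finally show ?thesis using full by simp
    next
      case False
      have "(\<Sum>t\<in>F. \<bar>coord y t\<bar>) = (\<Sum>t\<in>F. \<bar>coord x' t\<bar>)"
        using False by (intro sum.cong) (auto simp: y)
      also have "\<dots> \<le> 1"
        using x'(1) F by (auto simp: positive_unit_ball_iff norm_tree_space_le_iff tree_norm_le_iff)
      finally show ?thesis .
    qed
  qed
  then have "y \<in> positive_unit_ball"
    using y_nn by (simp add: positive_unit_ball_iff norm_tree_space_le_iff)
  moreover have "\<alpha> < blinfun_apply f y"
  proof -
    have "\<bar>a * blinfun_apply f (unit_vector s')\<bar> \<le> \<bar>blinfun_apply f (unit_vector s')\<bar>"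
      using a by (simp add: abs_mult mult_left_le_one_le)
    then show ?thesis
      using s'(3) by (simp add: y_def blinfun.add_right blinfun.scaleR_right)
  qed
  ultimately show ?thesis
    using that[OF s'(1)] full by simp
qed

text \<open>Summation along a chain is a functional of norm at most \<open>1\<close>.\<close>

lemma coord_summable_on_chain:
  assumes "C \<in> tree_chains"
  shows "coord x summable_on C" "\<bar>\<Sum>\<^sub>\<infinity>t\<in>C. coord x t\<bar> \<le> norm x"
proof -
  have *: "(\<lambda>t. \<bar>coord x t\<bar>) summable_on C" "(\<Sum>\<^sub>\<infinity>t\<in>C. \<bar>coord x t\<bar>) \<le> norm x"
    using assms norm_tree_space_le_iff[of x "norm x"] by (auto simp: tree_norm_le_def)
  then have abs: "(\<lambda>t. norm (coord x t)) summable_on C" by simp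
  then show "coord x summable_on C" by (rule abs_summable_summable)
  show "\<bar>\<Sum>\<^sub>\<infinity>t\<in>C. coord x t\<bar> \<le> norm x"
    using norm_infsum_bound[OF abs] *(2) by simp
qed

text \<open>
  The nodes \<open>s n\<close> are chosen recursively, the \<open>n\<close>-th slice being treated in the step from \<open>s n\<close> to
  \<open>s (Suc n)\<close>. Their initial segments form the chain \<open>C\<close> on which every chosen point has mass at
  least \<open>1\<close>.
\<close>

theorem positive_unit_ball_not_SCD: "\<not> SCD_set positive_unit_ball"
proof
  assume "SCD_set positive_unit_ball"
  then obtain I :: "nat set" and S where sl: "\<And>i. i \<in> I \<Longrightarrow> is_slice positive_unit_ball (S i)"
    and det: "determining positive_unit_ball I S"
    unfolding SCD_set_def by blast
  have step: "\<exists>s'. prefix s s' \<and>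
      (n \<in> I \<longrightarrow> (\<exists>y\<in>S n. (\<Sum>t\<in>set (prefixes s'). coord y t) \<ge> 1))" for n s
  proof (cases "n \<in> I")
    case True
    from sl[OF True] obtain f \<delta> where S: "S n = slice positive_unit_ball f \<delta>"
      unfolding is_slice_def by blast
    obtain x where "x \<in> S n"
      using det True unfolding determining_def by blast
    then have "x \<in> positive_unit_ball"
        "(SUP a\<in>positive_unit_ball. blinfun_apply f a) - \<delta> < blinfun_apply f x"
      unfolding S slice_def by auto
    then obtain s' y where "prefix s s'" "y \<in> positive_unit_ball"
      "(SUP a\<in>positive_unit_ball. blinfun_apply f a) - \<delta> < blinfun_apply f y"
      "(\<Sum>t\<in>set (prefixes s'). coord y t) \<ge> 1"
      using slice_point_full_below_node[of x _ f s] by blast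
    then show ?thesis unfolding S slice_def by blast
  qed auto
  have "\<exists>s. \<forall>n. True \<and> (prefix (s n) (s (Suc n)) \<and>
      (n \<in> I \<longrightarrow> (\<exists>y\<in>S n. (\<Sum>t\<in>set (prefixes (s (Suc n))). coord y t) \<ge> 1)))"
    by (rule dependent_nat_choice) (use step in auto)
  then obtain s :: "nat \<Rightarrow> bool list" where s: "\<And>n. prefix (s n) (s (Suc n))"
      "\<And>n. n \<in> I \<Longrightarrow> \<exists>y\<in>S n. (\<Sum>t\<in>set (prefixes (s (Suc n))). coord y t) \<ge> 1"
    by blast
  from s(2) obtain y where y: "\<And>n. n \<in> I \<Longrightarrow> y n \<in> S n"
      "\<And>n. n \<in> I \<Longrightarrow> (\<Sum>t\<in>set (prefixes (s (Suc n))). coord (y n) t) \<ge> 1"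
    by metis
  have y_nn: "coord (y n) t \<ge> 0" if "n \<in> I" for n t
  proof -
    have "y n \<in> positive_unit_ball"
      using y(1)[OF that] det that unfolding determining_def by blast
    then show ?thesis by (simp add: positive_unit_ball_iff)
  qed
  have mono: "prefix (s m) (s n)" if "m \<le> n" for m n
    using that by (induction rule: dec_induct) (use s(1) prefix_order.trans in auto)
  define C where "C = (\<Union>n. set (prefixes (s n)))"
  have chain: "C \<in> tree_chains"
    unfolding tree_chains_def Complete_Partial_Order.chain_def
  proof (safe)
    assume "C = {}" then show False by (auto simp: C_def)
  next
    fix t u assume "t \<in> C" "u \<in> C" and n: "\<not> prefix u t"
    then obtain m n where "prefix t (s m)" "prefix u (s n)"
      by (auto simp: C_def)
    then have "prefix t (s (max m n))" "prefix u (s (max m n))"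
      using mono[of m "max m n"] mono[of n "max m n"] prefix_order.trans by fastforce+
    then show "prefix t u" using n prefix_same_cases by blast
  qed
  define H where "H = {x. (\<Sum>\<^sub>\<infinity>t\<in>C. coord x t) \<ge> 1}"
  have "convex H"
  proof (rule convexI)
    fix x x' :: tree_space and u v :: real
    assume *: "x \<in> H" "x' \<in> H" and uv: "0 \<le> u" "0 \<le> v" "u + v = 1"
    have "(\<Sum>\<^sub>\<infinity>t\<in>C. coord (u *\<^sub>R x + v *\<^sub>R x') t)
        = u * (\<Sum>\<^sub>\<infinity>t\<in>C. coord x t) + v * (\<Sum>\<^sub>\<infinity>t\<in>C. coord x' t)"
      unfolding coord_simps
      by (subst infsum_add)
        (auto intro!: summable_on_cmult_right coord_summable_on_chain chain simp: infsum_cmult_right')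
    also have "\<dots> \<ge> u * 1 + v * 1"
      using * uv by (intro add_mono mult_left_mono) (auto simp: H_def)
    finally show "u *\<^sub>R x + v *\<^sub>R x' \<in> H"
      using uv by (simp add: H_def)
  qed
  moreover have "y ` I \<subseteq> H"
  proof safe
    fix n assume n: "n \<in> I"
    have "1 \<le> (\<Sum>t\<in>set (prefixes (s (Suc n))). coord (y n) t)"
      by (rule y(2)[OF n])
    also have "\<dots> = (\<Sum>\<^sub>\<infinity>t\<in>set (prefixes (s (Suc n))). coord (y n) t)"
      by simp
    also have "\<dots> \<le> (\<Sum>\<^sub>\<infinity>t\<in>C. coord (y n) t)"
    proof (rule infsum_mono_neutral)
      have "set (prefixes (s (Suc n))) \<subseteq> C" by (auto simp: C_def)
      then show "coord (y n) t \<le> 0" if "t \<in> set (prefixes (s (Suc n))) - C" for t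
        using that by blast
    qed (use coord_summable_on_chain(1) chain chain_prefixes y_nn[OF n] in auto)
    finally show "y n \<in> H" by (simp add: H_def)
  qed
  ultimately have "convex hull (y ` I) \<subseteq> H"
    by (rule hull_minimal[rotated])
  also have "H \<subseteq> {x. 1 \<le> norm x}"
    unfolding H_def using coord_summable_on_chain(2)[OF chain] by (smt (verit) Collect_mono)
  finally have "closure (convex hull (y ` I)) \<subseteq> {x. 1 \<le> norm x}"
    by (rule closure_minimal) (intro closed_Collect_le continuous_intros)
  moreover have "positive_unit_ball \<subseteq> closure (convex hull (y ` I))"
    using det y(1) unfolding determining_def by blast
  moreover have "0 \<in> positive_unit_ball"
    by (simp add: positive_unit_ball_iff coord_simps)
  ultimately show False by auto
qed

section \<open>Weak neighbourhoods in spaces with the Daugavet property\<close>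

lemma dim_range_rank_one:
  fixes g :: "'z::real_vector \<Rightarrow> real"
  assumes "linear g" "g p \<noteq> 0" "v \<noteq> 0"
  shows "dim (range (\<lambda>x. g x *\<^sub>R v)) = 1"
proof -
  have "range (\<lambda>x. g x *\<^sub>R v) = span {v}"
  proof -
    have "a *\<^sub>R v \<in> range (\<lambda>x. g x *\<^sub>R v)" for a
      by (rule range_eqI[of _ _ "(a / g p) *\<^sub>R p"]) (use assms(2) in \<open>simp add: linear_scale[OF assms(1)]\<close>)
    then show ?thesis unfolding span_singleton by blast
  qed
  moreover have "dim (span {v}) = card {v}"
    by (rule dim_span_eq_card_independent) (use assms(3) in simp)
  ultimately show ?thesis by simp
qed

text \<open>
  For \<open>w \<noteq> 0\<close> and \<open>g \<noteq> 0\<close> the Daugavet equation is applied to the operator \<open>R x = g x *\<^sub>R v\<close>, where \<open>v\<close> is the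
  positive multiple of \<open>w\<close> for which \<open>R\<close> has norm \<open>1\<close>. A unit vector \<open>y\<close> with
  \<open>\<parallel>y + R y\<parallel> \<approx> 2\<close> and, after a change of sign, \<open>g y \<ge> 0\<close> must have \<open>g y \<approx> \<parallel>g\<parallel>\<close>. So \<open>y\<close> is in the slice,
  and \<open>R y\<close> is nearly the unit vector \<open>w0\<close> in the direction of \<open>w\<close>.
\<close>

lemma Daugavet_slice:
  fixes g :: "'z::banach \<Rightarrow>\<^sub>L real"
  assumes D: "Daugavet_property TYPE('z)"
    and p: "norm p \<le> 1" "\<alpha> < blinfun_apply g p" and "\<delta> > 0"
  obtains y where "norm y \<le> 1" "\<alpha> < blinfun_apply g y" "norm (w + y) > norm w + 1 - \<delta>"
proof -
  have main: "\<exists>y. norm y \<le> 1 \<and> \<alpha> < blinfun_apply g y \<and> norm (w + y) > norm w + 1 - \<delta>"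
    if w: "w \<noteq> 0" for w
  proof (cases "g = 0")
    case True
    have "w + (1 / norm w) *\<^sub>R w = (1 + 1 / norm w) *\<^sub>R w"
      by (simp add: algebra_simps)
    then have "norm (w + (1 / norm w) *\<^sub>R w) = norm w + 1"
      using w by (simp add: field_simps)
    then show ?thesis
      using True p(2) w \<open>\<delta> > 0\<close> by (intro exI[of _ "(1 / norm w) *\<^sub>R w"]) auto
  next
    case False
    have ng: "norm g > 0" using False by simp
    have "blinfun_apply g p \<le> norm g"
      using norm_blinfun[of g p] p(1) mult_left_le[OF p(1), of "norm g"] by auto
    then have \<alpha>: "\<alpha> < norm g" using p(2) by simp
    define v where "v = (1 / (norm w * norm g)) *\<^sub>R w"
    define w0 where "w0 = (1 / norm w) *\<^sub>R w"
    have w0: "norm w0 = 1" and w0_w: "norm w *\<^sub>R w0 = w" using w by (simp_all add: w0_def)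
    define R where "R = Blinfun (\<lambda>x. blinfun_apply g x *\<^sub>R v)"
    have R: "blinfun_apply R = (\<lambda>x. blinfun_apply g x *\<^sub>R v)"
      unfolding R_def by (rule bounded_linear_Blinfun_apply) (intro bounded_linear_intros)
    have v: "norm v = 1 / norm g" using w by (simp add: v_def)
    obtain p' where "blinfun_apply g p' \<noteq> 0"
      using False by (metis blinfun_eqI zero_blinfun.rep_eq)
    then have "dim (range (blinfun_apply R)) = 1"
      unfolding R using w ng
      by (intro dim_range_rank_one) (auto simp: v_def blinfun.bounded_linear_right bounded_linear.linear)
    then have DE: "norm (id_blinfun + R) = 1 + norm R"
      using D unfolding Daugavet_property_def by blast
    have "norm g \<le> norm R * norm g"
    proof (rule norm_blinfun_bound)
      fix x
      have "norm (blinfun_apply g x) * (1 / norm g) \<le> norm R * norm x"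
        using norm_blinfun[of R x] v by (simp add: R)
      then show "norm (blinfun_apply g x) \<le> norm R * norm g * norm x"
        using ng by (simp add: field_simps)
    qed simp
    then have nR: "norm R \<ge> 1" using ng by simp
    (* The bounds on \<kappa> serve, in this order: g x \<noteq> 0 for a vector x at which id + R nearly attains
       its norm, membership in the slice, and the passage from w0 to w, which costs at most
       2 * \<kappa> * max 1 (norm w). *)
    define \<kappa> where "\<kappa> = min 1 (min (1 - \<alpha> / norm g) (\<delta> / (2 * (norm w + 2))))"
    have nw: "2 * (norm w + 2) > 0" by (intro mult_pos_pos add_nonneg_pos) auto
    have \<kappa>: "\<kappa> > 0" "\<kappa> \<le> 1" "\<kappa> \<le> 1 - \<alpha> / norm g" "\<kappa> \<le> \<delta> / (2 * (norm w + 2))"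
      using ng \<alpha> \<open>\<delta> > 0\<close> nw by (auto simp: \<kappa>_def)
    have \<kappa>2: "2 * \<kappa> * norm w + 4 * \<kappa> \<le> \<delta>"
      using \<kappa>(4) nw by (simp add: field_simps)
    have "\<exists>x. norm (x + blinfun_apply R x) > (2 - \<kappa>) * norm x"
    proof (rule ccontr)
      assume "\<not> ?thesis"
      then have "norm (id_blinfun + R) \<le> 2 - \<kappa>"
        using \<kappa>(2) by (intro norm_blinfun_bound)
          (auto simp: not_less plus_blinfun.rep_eq)
      then show False using DE nR \<kappa>(1) by simp
    qed
    then obtain x where x: "norm (x + blinfun_apply R x) > (2 - \<kappa>) * norm x" by blast
    then have x0: "x \<noteq> 0" by (auto simp: blinfun.zero_right)
    define y where "y = (sgn (blinfun_apply g x) / norm x) *\<^sub>R x"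
    define \<theta> where "\<theta> = blinfun_apply g y / norm g"
    have Rn: "norm (blinfun_apply R x) = \<bar>blinfun_apply g x\<bar> / norm g"
      by (simp add: R v)
    have gy: "blinfun_apply g y = \<bar>blinfun_apply g x\<bar> / norm x"
      by (simp add: y_def blinfun.scaleR_right abs_sgn mult.commute)
    have "\<bar>blinfun_apply g x\<bar> / norm g > (1 - \<kappa>) * norm x"
      using x norm_triangle_ineq[of x "blinfun_apply R x"] unfolding Rn by (simp add: algebra_simps)
    then have \<theta>: "\<theta> > 1 - \<kappa>"
      using x0 ng by (simp add: \<theta>_def gy field_simps)
    have gx0: "blinfun_apply g x \<noteq> 0"
      using \<theta> \<kappa>(2) by (auto simp: \<theta>_def gy)
    then have ny: "norm y = 1"
      using x0 by (simp add: y_def sgn_if)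
    have "\<theta> \<le> 1"
      using norm_blinfun[of g y] ny ng by (simp add: \<theta>_def field_simps)
    have "y + \<theta> *\<^sub>R w0 = (sgn (blinfun_apply g x) / norm x) *\<^sub>R (x + blinfun_apply R x)"
      using w ng by (simp add: y_def \<theta>_def R w0_def v_def blinfun.scaleR_right algebra_simps)
    then have "norm (y + \<theta> *\<^sub>R w0) = norm (x + blinfun_apply R x) / norm x"
      using gx0 by (simp add: sgn_if)
    then have 1: "norm (y + \<theta> *\<^sub>R w0) > 2 - \<kappa>"
      using x x0 by (simp add: pos_less_divide_eq)
    have "norm (y + \<theta> *\<^sub>R w0) \<le> norm (w0 + y) + norm ((1 - \<theta>) *\<^sub>R w0)"
      using norm_triangle_ineq4[of "w0 + y" "(1 - \<theta>) *\<^sub>R w0"] by (simp add: algebra_simps)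
    then have 2: "norm (w0 + y) > 2 - 2 * \<kappa>"
      using 1 \<theta> \<open>\<theta> \<le> 1\<close> w0 by simp
    (* Passage from w0 to w. If w is long, stretch both w0 and y by norm w and take off the excess
       of y; if w is short, shorten w0. *)
    have "norm (w + y) > norm w + 1 - \<delta>"
    proof (cases "norm w \<ge> 1")
      case True
      have "norm w * norm (w0 + y) = norm (w + norm w *\<^sub>R y)"
      proof -
        have "w + norm w *\<^sub>R y = norm w *\<^sub>R (w0 + y)"
          using w0_w by (simp add: scaleR_add_right)
        then show ?thesis by simp
      qed
      also have "\<dots> \<le> norm (w + y) + norm ((norm w - 1) *\<^sub>R y)"
        using norm_triangle_ineq[of "w + y" "(norm w - 1) *\<^sub>R y"] by (simp add: algebra_simps)
      also have "\<dots> = norm (w + y) + norm w - 1"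
        using True ny by simp
      finally have "norm w * (2 - 2 * \<kappa>) \<le> norm (w + y) + norm w - 1"
        using 2 mult_left_mono[of "2 - 2 * \<kappa>" "norm (w0 + y)" "norm w"] by simp
      then show ?thesis using \<kappa>2 \<kappa>(1) by (simp add: algebra_simps)
    next
      case False
      have "w0 + y = (w + y) + (1 - norm w) *\<^sub>R w0"
        using w0_w by (simp add: scaleR_diff_left)
      then have "norm (w0 + y) \<le> norm (w + y) + norm ((1 - norm w) *\<^sub>R w0)"
        by (metis norm_triangle_ineq)
      then have "norm (w0 + y) \<le> norm (w + y) + (1 - norm w)"
        using False w0 by simp
      moreover have "2 * \<kappa> * norm w \<ge> 0" using \<kappa>(1) by simp
      ultimately show ?thesis using 2 \<kappa>2 \<kappa>(1) by linarith
    qed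
    moreover have "\<alpha> < blinfun_apply g y"
    proof -
      have "\<alpha> / norm g < \<theta>" using \<theta> \<kappa>(3) by simp
      then show ?thesis using ng by (simp add: \<theta>_def divide_less_cancel)
    qed
    ultimately show ?thesis using ny by (intro exI[of _ y]) auto
  qed
  show ?thesis
  proof (cases "w = 0")
    case True
    (* Any y that works for some nonzero z has norm y > 1 - \<delta>, by the triangle inequality. *)
    obtain z :: 'z where "z \<noteq> 0"
      using D unfolding Daugavet_property_def by blast
    from main[OF this] obtain y where y: "norm y \<le> 1" "\<alpha> < blinfun_apply g y"
      "norm (z + y) > norm z + 1 - \<delta>" by blast
    then show ?thesis
      using that[OF y(1,2)] True norm_triangle_ineq[of z y] by simp
  next
    case False
    from main[OF this] that show ?thesis by blast
  qed
qed

text \<open>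
  A positive semidefinite form \<open>B\<close> measures weak nearness; for the application
  \<open>B x y = (\<Sum>t\<in>A. \<phi> t x * \<phi> t y)\<close> with finitely many functionals. Working with \<open>B\<close> rather than with a
  map into a Euclidean space leaves the number of functionals free.

  Let \<open>G\<close> be the set of those points of the ball that satisfy the claim up to a fixed error \<open>\<eta>\<close> in
  the seminorm of \<open>B\<close>. It is convex: for a combination \<open>u z\<^sub>1 + v z\<^sub>2\<close>, choose \<open>y\<^sub>1\<close> near \<open>z\<^sub>1\<close> that
  adds its full length to \<open>w\<close>, and then \<open>y\<^sub>2\<close> near \<open>z\<^sub>2\<close> that adds its full length to \<open>w + u y\<^sub>1\<close>. It
  contains every point \<open>p\<close> of the ball nearly at maximal distance from some centre \<open>c\<close>, because the
  slice cut out by \<open>B _ (p - c)\<close> at \<open>p\<close> has a small diameter and meets the requirement on norms by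
  the Daugavet property. Such points are enough: if a point \<open>z\<close> of the ball stayed away from \<open>G\<close>, then
  some direction \<open>a\<close> would separate it from \<open>G\<close>, and from a centre far out in direction \<open>- a\<close>,
  \<open>z\<close> would be further away than the furthest points.
\<close>

lemma Daugavet_near_point:
  fixes B :: "'z::banach \<Rightarrow> 'z \<Rightarrow> real"
  assumes D: "Daugavet_property TYPE('z)"
    and B: "bounded_bilinear B" and sym: "\<And>x y. B x y = B y x" and pos: "\<And>x. B x x \<ge> 0"
    and z: "norm z \<le> 1" and "\<epsilon> > 0"
  obtains y where "norm y \<le> 1" "B (y - z) (y - z) < \<epsilon>" "norm (w + y) > norm w + 1 - \<epsilon>"
proof -
  interpret B: bounded_bilinear B by (rule B)
  define q where "q x = B x x" for x
  note bil = B.add_left B.add_right B.diff_left B.diff_right B.scaleR_left B.scaleR_right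
  obtain K where K: "K > 0" "\<And>x y. norm (B x y) \<le> norm x * norm y * K"
    using B.pos_bounded by blast
  have q_bound: "q x \<le> K * (norm x)\<^sup>2" for x
    using K(2)[of x x] by (simp add: q_def power2_eq_square mult.commute)
  have q_pos: "q x \<ge> 0" for x by (simp add: q_def pos)
  have q_diff: "q (x - s *\<^sub>R y) = q x - 2 * s * B x y + s\<^sup>2 * q y" for x y s
    by (simp add: q_def bil sym[of y x] power2_eq_square algebra_simps)
  define \<eta> where "\<eta> = \<epsilon> / 4"
  have \<eta>: "\<eta> > 0" using \<open>\<epsilon> > 0\<close> by (simp add: \<eta>_def)
  define G where "G = {z. norm z \<le> 1 \<and>
     (\<forall>w. \<forall>\<delta>>0. \<exists>y. norm y \<le> 1 \<and> q (y - z) \<le> \<eta> \<and> norm (w + y) > norm w + 1 - \<delta>)}"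
  have "convex G"
  proof (rule convexI)
    fix z1 z2 and u v :: real
    assume z12: "z1 \<in> G" "z2 \<in> G" and uv: "0 \<le> u" "0 \<le> v" "u + v = 1"
    show "u *\<^sub>R z1 + v *\<^sub>R z2 \<in> G"
    proof (cases "u = 0 \<or> v = 0")
      case True
      then show ?thesis using z12 uv by auto
    next
      case False
      then have uv0: "u > 0" "v > 0" using uv by auto
      have comb: "norm (u *\<^sub>R a + v *\<^sub>R b) \<le> 1" if "norm a \<le> 1" "norm b \<le> 1" for a b :: 'z
        using convexD[OF convex_cball[of "0 :: 'z" 1], of a b u v] that uv by simp
      have "\<exists>y. norm y \<le> 1 \<and> q (y - (u *\<^sub>R z1 + v *\<^sub>R z2)) \<le> \<eta> \<and> norm (w + y) > norm w + 1 - \<delta>"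
        if "\<delta> > 0" for w \<delta>
      proof -
        have scale: "norm (w + c *\<^sub>R y) > norm w + c - c * \<delta>"
          if "c > 0" "norm ((1 / c) *\<^sub>R w + y) > norm ((1 / c) *\<^sub>R w) + 1 - \<delta>" for c w and y :: 'z
        proof -
          have "w + c *\<^sub>R y = c *\<^sub>R ((1 / c) *\<^sub>R w + y)"
            using that(1) by (simp add: scaleR_add_right)
          then have "norm (w + c *\<^sub>R y) = c * norm ((1 / c) *\<^sub>R w + y)"
            using that(1) by simp
          also have "\<dots> > c * (norm ((1 / c) *\<^sub>R w) + 1 - \<delta>)"
            using that by (intro mult_strict_left_mono)
          also have "c * (norm ((1 / c) *\<^sub>R w) + 1 - \<delta>) = norm w + c - c * \<delta>"
            using that(1) by (simp add: algebra_simps)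
          finally show ?thesis .
        qed
        obtain y1 where y1: "norm y1 \<le> 1" "q (y1 - z1) \<le> \<eta>"
            "norm ((1 / u) *\<^sub>R w + y1) > norm ((1 / u) *\<^sub>R w) + 1 - \<delta>"
          using z12(1) \<open>\<delta> > 0\<close> unfolding G_def by blast
        define w' where "w' = w + u *\<^sub>R y1"
        obtain y2 where y2: "norm y2 \<le> 1" "q (y2 - z2) \<le> \<eta>"
            "norm ((1 / v) *\<^sub>R w' + y2) > norm ((1 / v) *\<^sub>R w') + 1 - \<delta>"
          using z12(2) \<open>\<delta> > 0\<close> unfolding G_def by blast
        have "norm (w' + v *\<^sub>R y2) > norm w + u - u * \<delta> + v - v * \<delta>"
          using scale[OF uv0(1) y1(3)] scale[OF uv0(2) y2(3)] unfolding w'_def by linarith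
        moreover have "norm w + u - u * \<delta> + v - v * \<delta> = norm w + (u + v) - (u + v) * \<delta>"
          by (simp add: algebra_simps)
        ultimately have 1: "norm (w + (u *\<^sub>R y1 + v *\<^sub>R y2)) > norm w + 1 - \<delta>"
          using uv(3) by (simp add: w'_def add.assoc)
        have "q (u *\<^sub>R a + v *\<^sub>R b) = u * q a + v * q b - u * v * q (a - b)" for a b
        proof -
          have v: "v = 1 - u" using uv by simp
          show ?thesis
            unfolding v by (simp add: q_def bil sym[of b a] algebra_simps)
        qed
        then have "q (u *\<^sub>R (y1 - z1) + v *\<^sub>R (y2 - z2)) \<le> u * q (y1 - z1) + v * q (y2 - z2)"
          using uv q_pos by simp
        also have "\<dots> \<le> u * \<eta> + v * \<eta>"
          using uv y1 y2 by (intro add_mono mult_left_mono) auto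
        also have "\<dots> = \<eta>" using uv(3) by (simp flip: distrib_right)
        finally have 2: "q ((u *\<^sub>R y1 + v *\<^sub>R y2) - (u *\<^sub>R z1 + v *\<^sub>R z2)) \<le> \<eta>"
          by (simp add: algebra_simps)
        show ?thesis
          using 1 2 comb[OF y1(1) y2(1)] by blast
      qed
      then show ?thesis
        using comb z12 unfolding G_def by blast
    qed
  qed
  have far: "\<exists>p\<in>G. \<forall>x. norm x \<le> 1 \<longrightarrow> q (x - c) < q (p - c) + \<eta> / 2" for c
  proof -
    have ne: "cball (0::'z) 1 \<noteq> {}" by simp
    have bdd: "bdd_above ((\<lambda>x. q (x - c)) ` cball 0 1)"
    proof (rule bdd_aboveI2)
      fix x :: 'z assume "x \<in> cball 0 1"
      then have "norm (x - c) \<le> 1 + norm c"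
        using norm_triangle_ineq4[of x c] by simp
      then have "K * (norm (x - c))\<^sup>2 \<le> K * (1 + norm c)\<^sup>2"
        using K(1) by (intro mult_left_mono power_mono) auto
      then show "q (x - c) \<le> K * (1 + norm c)\<^sup>2"
        using q_bound[of "x - c"] by simp
    qed
    have "(SUP x\<in>cball 0 1. q (x - c)) - \<eta> / 2 < (SUP x\<in>cball 0 1. q (x - c))"
      using \<eta> by simp
    then obtain p where p: "norm p \<le> 1" "(SUP x\<in>cball 0 1. q (x - c)) - \<eta> / 2 < q (p - c)"
      unfolding less_cSUP_iff[OF ne bdd] by auto
    have pmax: "q (x - c) < q (p - c) + \<eta> / 2" if "norm x \<le> 1" for x
      using cSUP_upper[OF _ bdd, of x] that p(2) by simp
    define g where "g = Blinfun (\<lambda>x. B x (p - c))"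
    have g: "blinfun_apply g = (\<lambda>x. B x (p - c))"
      unfolding g_def by (rule bounded_linear_Blinfun_apply) (rule B.bounded_linear_left)
    have near: "q (x - p) \<le> \<eta>" if x: "norm x \<le> 1" "B p (p - c) - \<eta> / 4 < blinfun_apply g x" for x
    proof -
      have "q (x - p) = q (x - c) + q (p - c) - 2 * B (x - c) (p - c)"
        using q_diff[of "x - c" 1 "p - c"] by simp
      moreover have "B (x - c) (p - c) > q (p - c) - \<eta> / 4"
        using x(2) by (simp add: g q_def bil)
      ultimately show ?thesis using pmax[OF x(1)] by linarith
    qed
    have "\<exists>y. norm y \<le> 1 \<and> q (y - p) \<le> \<eta> \<and> norm (w + y) > norm w + 1 - \<delta>"
      if "\<delta> > 0" for w \<delta>
    proof -
      have "B p (p - c) - \<eta> / 4 < blinfun_apply g p" using \<eta> by (simp add: g)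
      from Daugavet_slice[OF D p(1) this that] obtain y where
        "norm y \<le> 1" "B p (p - c) - \<eta> / 4 < blinfun_apply g y" "norm (w + y) > norm w + 1 - \<delta>"
        by blast
      with near show ?thesis by blast
    qed
    then have "p \<in> G" using p(1) by (simp add: G_def)
    then show ?thesis using pmax by blast
  qed
  have "\<exists>c\<in>G. q (z - c) < \<eta>"
  proof (rule ccontr)
    assume "\<not> ?thesis"
    then have ge: "q (z - c) \<ge> \<eta>" if "c \<in> G" for c using that by force
    have ne: "G \<noteq> {}" using far by blast
    (* Separation of z from the convex set G by a nearly closest point c0: moving from c0 towards
       another point c of G by a small factor s hardly decreases the distance from z. *)
    define d where "d = (INF c\<in>G. q (z - c))"
    have bdd: "bdd_below ((\<lambda>c. q (z - c)) ` G)"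
      using q_pos by (intro bdd_belowI2[where m=0])
    have d: "d \<ge> \<eta>" unfolding d_def by (rule cINF_greatest[OF ne ge])
    have dle: "d \<le> q (z - c)" if "c \<in> G" for c
      unfolding d_def using bdd that by (rule cINF_lower)
    define s where "s = min 1 (d / (8 * K))"
    have s: "s > 0" "s \<le> 1" "s \<le> d / (8 * K)" using d \<eta> K(1) by (auto simp: s_def)
    have "d < d + s * d / 2" using s d \<eta> by simp
    then obtain c0 where c0: "c0 \<in> G" "q (z - c0) < d + s * d / 2"
      unfolding d_def cINF_less_iff[OF ne bdd] by auto
    define a where "a = z - c0"
    have sep: "B a (z - c) \<ge> d / 2" if c: "c \<in> G" for c
    proof -
      have "c0 + s *\<^sub>R (c - c0) = (1 - s) *\<^sub>R c0 + s *\<^sub>R c"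
        by (simp add: algebra_simps)
      also have "\<dots> \<in> G"
        using convexD[OF \<open>convex G\<close> c0(1) c, of "1 - s" s] s by simp
      finally have "d \<le> q (a - s *\<^sub>R (c - c0))"
        using dle unfolding a_def by (metis diff_diff_add)
      then have "2 * s * B a (c - c0) \<le> s * d / 2 + s\<^sup>2 * q (c - c0)"
        using c0(2) unfolding q_diff a_def by linarith
      also have "q (c - c0) \<le> 4 * K"
      proof -
        have "norm (c - c0) \<le> 2"
          using norm_triangle_ineq4[of c c0] c c0(1) by (simp add: G_def)
        then have "(norm (c - c0))\<^sup>2 \<le> 2\<^sup>2" by (intro power_mono) auto
        then have "K * (norm (c - c0))\<^sup>2 \<le> K * 4" using K(1) by (intro mult_left_mono) auto
        then show ?thesis using q_bound[of "c - c0"] by simp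
      qed
      then have "s * d / 2 + s\<^sup>2 * q (c - c0) \<le> s * d / 2 + s\<^sup>2 * (4 * K)"
        by (intro add_left_mono mult_left_mono) auto
      finally have "s * (2 * B a (c - c0)) \<le> s * (d / 2 + 4 * K * s)"
        by (simp add: algebra_simps power2_eq_square)
      then have "2 * B a (c - c0) \<le> d / 2 + 4 * K * s" using s(1) by simp
      moreover have "4 * K * s \<le> d / 2" using s(3) K(1) by (simp add: field_simps)
      ultimately have "B a (c - c0) \<le> d / 2" by linarith
      moreover have "B a (z - c) = q a - B a (c - c0)"
        by (simp add: q_def a_def bil)
      ultimately show ?thesis using dle[OF c0(1)] by (simp add: a_def)
    qed
    (* The separation gains 2 * t * (d / 2) = K + \<eta>, more than q p + \<eta> / 2 can make up for. *)
    define t where "t = (K + \<eta>) / d"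
    obtain p where p: "p \<in> G" "\<And>x. norm x \<le> 1 \<Longrightarrow> q (x - (- t) *\<^sub>R a) < q (p - (- t) *\<^sub>R a) + \<eta> / 2"
      using far by blast
    have "q z + 2 * t * B z a < q p + 2 * t * B p a + \<eta> / 2"
      using p(2)[OF z] unfolding q_diff by simp
    moreover have "B z a - B p a \<ge> d / 2" using sep[OF p(1)] by (simp add: bil sym[of a])
    then have "2 * t * (B z a - B p a) \<ge> 2 * t * (d / 2)"
      using K(1) \<eta> d by (intro mult_left_mono) (auto simp: t_def)
    moreover have "2 * t * (d / 2) = K + \<eta>" using d \<eta> by (simp add: t_def)
    moreover have "q p \<le> K"
    proof -
      have "(norm p)\<^sup>2 \<le> 1" using p(1) by (simp add: G_def power_le_one)
      then show ?thesis using q_bound[of p] K(1) by (smt (verit) mult_left_le)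
    qed
    ultimately show False using q_pos[of z] \<eta> by (simp add: algebra_simps)
  qed
  then obtain c where c: "c \<in> G" "q (z - c) < \<eta>" by blast
  then obtain y where y: "norm y \<le> 1" "q (y - c) \<le> \<eta>" "norm (w + y) > norm w + 1 - \<epsilon>"
    using \<open>\<epsilon> > 0\<close> unfolding G_def by blast
  have "q (a - b) + q (a + b) = 2 * q a + 2 * q b" for a b
    by (simp add: q_def bil)
  (* The parallelogram identity gives q (y - z) \<le> 2 * \<eta> + 2 * \<eta>, whence the factor 4 in \<eta>. *)
  from this[of "y - c" "z - c"] have "q (y - z) \<le> 2 * q (y - c) + 2 * q (z - c)"
    using q_pos[of "(y - c) + (z - c)"] by simp
  also have "\<dots> < \<epsilon>" using c(2) y(2) by (simp add: \<eta>_def)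
  finally show ?thesis using that[OF y(1) _ y(3)] by (simp add: q_def)
qed

section \<open>No isomorphic copies of spaces with the Daugavet property\<close>

text \<open>
  Stated for a homogeneous map on a subspace in order to cover the inverse of an embedding, which
  is defined on the range only.
\<close>

lemma linear_continuous_bound:
  fixes f :: "'a::real_normed_vector \<Rightarrow> 'b::real_normed_vector"
  assumes Y: "subspace Y" and cont: "continuous_on Y f"
    and scale: "\<And>c x. x \<in> Y \<Longrightarrow> f (c *\<^sub>R x) = c *\<^sub>R f x"
  obtains M where "M > 0" "\<And>x. x \<in> Y \<Longrightarrow> norm (f x) \<le> M * norm x"
proof -
  have 0: "0 \<in> Y" by (rule subspace_0[OF Y])
  have f0: "f 0 = 0" using scale[OF 0, of 0] by simp
  obtain r where r: "r > 0" "\<And>x. x \<in> Y \<Longrightarrow> dist x 0 < r \<Longrightarrow> dist (f x) (f 0) < 1"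
    using cont 0 unfolding continuous_on_iff by (metis zero_less_one)
  have "norm (f x) \<le> 2 / r * norm x" if x: "x \<in> Y" for x
  proof (cases "x = 0")
    case False
    define c where "c = r / (2 * norm x)"
    have c: "c > 0" using r(1) False by (simp add: c_def)
    have "norm (c *\<^sub>R x) < r" using r(1) False by (simp add: c_def)
    then have "norm (f (c *\<^sub>R x)) < 1"
      using r(2)[of "c *\<^sub>R x"] subspace_scale[OF Y x] f0 by (simp add: dist_norm)
    then have "c * norm (f x) < 1" using c scale[OF x] by simp
    then show ?thesis using r(1) False by (simp add: c_def field_simps)
  qed (simp add: f0)
  then show ?thesis using r(1) by (intro that[of "2 / r"]) auto
qed

lemma bounded_bilinear_sum_mult:
  fixes \<phi> :: "'i \<Rightarrow> 'z::real_normed_vector \<Rightarrow> real"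
  assumes "\<And>t. bounded_linear (\<phi> t)"
  shows "bounded_bilinear (\<lambda>x y. \<Sum>t\<in>A. \<phi> t x * \<phi> t y)"
proof
  note lin = bounded_linear.linear[OF assms]
  fix a a' b b' :: 'z and r :: real
  show "(\<Sum>t\<in>A. \<phi> t (a + a') * \<phi> t b) = (\<Sum>t\<in>A. \<phi> t a * \<phi> t b) + (\<Sum>t\<in>A. \<phi> t a' * \<phi> t b)"
    "(\<Sum>t\<in>A. \<phi> t a * \<phi> t (b + b')) = (\<Sum>t\<in>A. \<phi> t a * \<phi> t b) + (\<Sum>t\<in>A. \<phi> t a * \<phi> t b')"
    by (simp_all add: linear_add[OF lin] sum.distrib algebra_simps)
  show "(\<Sum>t\<in>A. \<phi> t (r *\<^sub>R a) * \<phi> t b) = r *\<^sub>R (\<Sum>t\<in>A. \<phi> t a * \<phi> t b)"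
    "(\<Sum>t\<in>A. \<phi> t a * \<phi> t (r *\<^sub>R b)) = r *\<^sub>R (\<Sum>t\<in>A. \<phi> t a * \<phi> t b)"
    by (simp_all add: linear_scale[OF lin] sum_distrib_left mult_ac)
  have "norm (\<Sum>t\<in>A. \<phi> t a * \<phi> t b) \<le> norm a * norm b * (\<Sum>t\<in>A. onorm (\<phi> t) * onorm (\<phi> t))" for a b
  proof -
    have "norm (\<Sum>t\<in>A. \<phi> t a * \<phi> t b) \<le> (\<Sum>t\<in>A. (onorm (\<phi> t) * norm a) * (onorm (\<phi> t) * norm b))"
      by (intro order_trans[OF norm_sum] sum_mono, unfold norm_mult)
        (intro mult_mono onorm mult_nonneg_nonneg onorm_pos_le assms norm_ge_zero)
    then show ?thesis by (simp add: sum_distrib_left mult_ac)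
  qed
  then show "\<exists>K. \<forall>a b. norm (\<Sum>t\<in>A. \<phi> t a * \<phi> t b) \<le> norm a * norm b * K" by blast
qed

lemma bounded_linear_coord: "bounded_linear (\<lambda>x. coord x t)"
  by (rule bounded_linear_intro[where K=1]) (auto simp: coord_simps abs_coord_le_norm)

text \<open>
  Here \<open>y\<close> is the last of the vectors \<open>y\<^sub>1, \<dots>, y\<^sub>n\<close>, \<open>w\<close> is their sum, and \<open>\<sigma>\<close> is the pattern of signs
  that turns the alternating sum \<open>T y\<close> of the blocks into their plain sum \<open>T (2 w - y)\<close>. In the
  induction step \<open>y'\<close> is chosen near \<open>- y\<close> on a finite set \<open>A\<close> of coordinates off which
  \<open>T (2 w)\<close> is small. On \<open>A\<close>, \<open>T y' \<approx> - T y\<close>, so all signs are reversed there;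
  off \<open>A\<close>, only the new block counts, and its sign is \<open>1\<close>. The error is allowed to be any \<open>\<eta> > 0\<close> so
  that each step can halve it.
\<close>

lemma Daugavet_unconditional_sums:
  fixes T :: "'z::banach \<Rightarrow> tree_space"
  assumes D: "Daugavet_property TYPE('z)" and T: "bounded_linear T" and "\<eta> > 0"
  shows "\<exists>w y \<sigma>. norm y \<le> 1 \<and> real n / 2 \<le> norm w \<and> (\<forall>t. \<bar>\<sigma> t\<bar> = 1) \<and>
     tree_norm_le (\<lambda>t. coord (T (2 *\<^sub>R w - y)) t - \<sigma> t * coord (T y) t) \<eta>"
  using \<open>\<eta> > 0\<close>
proof (induction n arbitrary: \<eta>)
  case 0
  note lin = bounded_linear.linear[OF T]
  show ?case
    using 0 by (intro exI[of _ 0] exI[of _ "\<lambda>_. 1"])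
      (auto simp: linear_0[OF lin] coord_simps intro: tree_norm_le_mono[OF tree_norm_le_zero])
next
  case (Suc n)
  note lin = bounded_linear.linear[OF T]
  define \<epsilon> where "\<epsilon> = \<eta> / 8"
  have \<epsilon>: "\<epsilon> > 0" using Suc.prems by (simp add: \<epsilon>_def)
  obtain w y \<sigma> where y: "norm y \<le> 1" and w: "real n / 2 \<le> norm w" and \<sigma>: "\<And>t. \<bar>\<sigma> t\<bar> = 1"
    and IH: "tree_norm_le (\<lambda>t. coord (T (2 *\<^sub>R w - y)) t - \<sigma> t * coord (T y) t) (\<eta> / 2)"
    using Suc.IH[of "\<eta> / 2"] Suc.prems by auto
  define r where "r = coord (T (2 *\<^sub>R w - y))"
  obtain A where A: "finite A" "tree_norm_le (\<lambda>t. if t \<in> A then 0 else coord (T (2 *\<^sub>R w)) t) \<epsilon>"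
    using coord_small_off_finite[OF \<epsilon>] by blast
  define B where "B a b = (\<Sum>t\<in>A. coord (T a) t * coord (T b) t)" for a b
  have bil: "bounded_bilinear B"
    unfolding B_def by (rule bounded_bilinear_sum_mult) (rule bounded_linear_compose[OF bounded_linear_coord T])
  define \<kappa> where "\<kappa> = \<epsilon> / (card A + 1)"
  have \<kappa>: "\<kappa> > 0" using \<epsilon> by (simp add: \<kappa>_def)
  obtain y' where y': "norm y' \<le> 1" "B (y' - - y) (y' - - y) < min (1 / 2) (\<kappa>\<^sup>2)"
      "norm (w + y') > norm w + 1 - min (1 / 2) (\<kappa>\<^sup>2)"
  proof (rule Daugavet_near_point[OF D bil])
    show "B a b = B b a" "B a a \<ge> 0" for a b
      by (auto simp: B_def mult.commute intro: sum_nonneg)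
    show "norm (- y) \<le> 1" using y by simp
    show "min (1 / 2) (\<kappa>\<^sup>2) > 0" using \<kappa> by simp
  qed
  have small: "\<bar>coord (T (y' + y)) t\<bar> \<le> \<kappa>" if "t \<in> A" for t
  proof -
    have "(coord (T (y' + y)) t)\<^sup>2 \<le> B (y' + y) (y' + y)"
      unfolding B_def power2_eq_square using A(1) that by (intro member_le_sum) auto
    also have "\<dots> \<le> \<kappa>\<^sup>2" using y'(2) by simp
    finally show ?thesis using \<kappa> by (simp add: abs_le_square_iff[symmetric] flip: abs_le_square_iff)
  qed
  have near: "tree_norm_le (\<lambda>t. if t \<in> A then coord (T (y' + y)) t else 0) \<epsilon>"
    unfolding tree_norm_le_iff
  proof (intro ballI impI)
    fix F :: "bool list set" assume F: "finite F"
    have "(\<Sum>t\<in>F. \<bar>if t \<in> A then coord (T (y' + y)) t else 0\<bar>)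
        = (\<Sum>t\<in>F \<inter> A. \<bar>coord (T (y' + y)) t\<bar>)"
      using F by (intro sum.mono_neutral_cong_right) auto
    also have "\<dots> \<le> (\<Sum>t\<in>F \<inter> A. \<kappa>)"
      by (intro sum_mono small) auto
    also have "\<dots> \<le> (\<Sum>t\<in>A. \<kappa>)"
      using A(1) \<kappa> by (intro sum_mono2) auto
    also have "\<dots> \<le> \<epsilon>"
      using \<epsilon> by (simp add: \<kappa>_def field_simps)
    finally show "(\<Sum>t\<in>F. \<bar>if t \<in> A then coord (T (y' + y)) t else 0\<bar>) \<le> \<epsilon>" .
  qed
  define \<sigma>' where "\<sigma>' t = (if t \<in> A then - \<sigma> t else 1)" for t
  have \<sigma>': "\<bar>\<sigma>' t\<bar> = 1" for t using \<sigma> by (simp add: \<sigma>'_def)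
  (* With r = T (2 w - y), the new error vector is T (2 w + y') - \<sigma>' T y'. On A it equals
     (r - \<sigma> T y) + (1 + \<sigma>) T (y' + y); off A, where \<sigma>' = 1, it equals T (2 w). *)
  define E1 where "E1 t = (if t \<in> A then r t - \<sigma> t * coord (T y) t else 0)" for t
  define E2 where "E2 t = (1 + \<sigma> t) * (if t \<in> A then coord (T (y' + y)) t else 0)" for t
  define E3 where "E3 t = (if t \<in> A then 0 else coord (T (2 *\<^sub>R w)) t)" for t
  have "tree_norm_le E1 (\<eta> / 2)"
    by (rule tree_norm_le_dominated[OF IH]) (auto simp: E1_def r_def)
  moreover have "tree_norm_le E2 (\<bar>2\<bar> * \<epsilon>)"
  proof (rule tree_norm_le_dominated[OF tree_norm_le_scale[OF near]])
    fix t
    have "\<bar>1 + \<sigma> t\<bar> \<le> 2" using \<sigma>[of t] by linarith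
    then show "\<bar>E2 t\<bar> \<le> \<bar>2 * (if t \<in> A then coord (T (y' + y)) t else 0)\<bar>"
      unfolding E2_def abs_mult by (intro mult_right_mono) auto
  qed
  moreover have "tree_norm_le E3 \<epsilon>" using A(2) unfolding E3_def .
  ultimately have "tree_norm_le (\<lambda>t. E1 t + E2 t + E3 t) (\<eta> / 2 + \<bar>2\<bar> * \<epsilon> + \<epsilon>)"
    by (intro tree_norm_le_add)
  then have err: "tree_norm_le (\<lambda>t. E1 t + E2 t + E3 t) \<eta>"
    by (rule tree_norm_le_mono) (use Suc.prems in \<open>simp add: \<epsilon>_def\<close>)
  have "coord (T (2 *\<^sub>R (w + y') - y')) t - \<sigma>' t * coord (T y') t = E1 t + E2 t + E3 t" for t
    by (cases "t \<in> A")
      (simp_all add: E1_def E2_def E3_def \<sigma>'_def r_def linear_add[OF lin] linear_diff[OF lin]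
        linear_scale[OF lin] coord_simps algebra_simps)
  with err have "tree_norm_le (\<lambda>t. coord (T (2 *\<^sub>R (w + y') - y')) t - \<sigma>' t * coord (T y') t) \<eta>"
    by simp
  moreover have "real (Suc n) / 2 \<le> norm (w + y')"
    using w y'(3) by simp
  ultimately show ?case using y'(1) \<sigma>' by blast
qed

text \<open>
  Since signs of coordinates do not affect the norm, \<open>T (2 w - y)\<close> is bounded by about the norm of
  \<open>T\<close>, although \<open>2 w - y\<close> is arbitrarily long and \<open>T\<close> is bounded below.
\<close>

theorem Daugavet_not_in_tree_space:
  assumes D: "Daugavet_property TYPE('z::banach)"
  shows "\<not> contains_isomorphic_copy TYPE(tree_space) TYPE('z)"
proof
  assume "contains_isomorphic_copy TYPE(tree_space) TYPE('z)"
  then obtain Y :: "tree_space set" and T :: "'z \<Rightarrow> tree_space" and S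
    where Y: "subspace Y" and lin: "linear T" and homeo: "homeomorphism UNIV Y T S"
    unfolding contains_isomorphic_copy_def by blast
  have ST: "S (T x) = x" for x using homeo by (simp add: homeomorphism_def)
  have YT: "Y = range T" using homeo by (simp add: homeomorphism_def)
  obtain M where M: "M > 0" "\<And>x. norm (T x) \<le> M * norm x"
    using linear_continuous_bound[of UNIV T] homeo linear_scale[OF lin]
    by (auto simp: homeomorphism_def)
  have scale: "S (c *\<^sub>R x) = c *\<^sub>R S x" if "x \<in> Y" for c x
    using that ST by (auto simp: YT simp flip: linear_scale[OF lin])
  have "continuous_on Y S" using homeo by (simp add: homeomorphism_def)
  then obtain L where L: "L > 0" "\<And>x. x \<in> Y \<Longrightarrow> norm (S x) \<le> L * norm x"
    using linear_continuous_bound[OF Y _ scale] by blast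
  have bl: "bounded_linear T"
    using M(2) by (intro bounded_linear_intro[where K=M])
      (auto simp: linear_add[OF lin] linear_scale[OF lin] mult.commute)
  obtain n :: nat where n: "real n > L * (M + 1) + 1" using reals_Archimedean2 by blast
  obtain w y \<sigma> where y: "norm y \<le> 1" and w: "real n / 2 \<le> norm w" and \<sigma>: "\<And>t. \<bar>\<sigma> t\<bar> = 1"
    and close: "tree_norm_le (\<lambda>t. coord (T (2 *\<^sub>R w - y)) t - \<sigma> t * coord (T y) t) 1"
    using Daugavet_unconditional_sums[OF D bl, of 1 n] by auto
  have "norm (T y) \<le> M"
    using M(2)[of y] mult_left_le[OF y less_imp_le[OF M(1)]] by linarith
  then have "tree_norm_le (coord (T y)) M" by (simp add: norm_tree_space_le_iff)
  then have "tree_norm_le (\<lambda>t. \<sigma> t * coord (T y) t) M"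
    by (rule tree_norm_le_dominated) (simp add: abs_mult \<sigma>)
  from tree_norm_le_add[OF close this] have "norm (T (2 *\<^sub>R w - y)) \<le> M + 1"
    by (simp add: norm_tree_space_le_iff add.commute)
  then have "L * norm (T (2 *\<^sub>R w - y)) \<le> L * (M + 1)" using L(1) by (intro mult_left_mono) auto
  moreover have "norm (2 *\<^sub>R w - y) \<le> L * norm (T (2 *\<^sub>R w - y))"
    using L(2)[of "T (2 *\<^sub>R w - y)"] by (simp add: ST YT)
  moreover have "norm (2 *\<^sub>R w - y) \<ge> 2 * norm w - norm y"
    using norm_triangle_ineq2[of "2 *\<^sub>R w" y] by simp
  ultimately show False using n w y by linarith
qed

theorem theorem3p6:
  shows "\<not> SCD_set positive_unit_ball \<and>
    \<not> SCD_space TYPE(tree_space) \<and>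
    (Daugavet_property TYPE('z::banach) \<longrightarrow>
       \<not> contains_isomorphic_copy TYPE(tree_space) TYPE('z))"
proof (intro conjI impI)
  show "\<not> SCD_set positive_unit_ball" by (rule positive_unit_ball_not_SCD)
  have "bounded positive_unit_ball"
    by (rule boundedI[where B=1]) (simp add: positive_unit_ball_iff)
  moreover have "0 \<in> positive_unit_ball"
    by (simp add: positive_unit_ball_iff coord_simps)
  ultimately show "\<not> SCD_space TYPE(tree_space)"
    using positive_unit_ball_not_SCD unfolding SCD_space_def by blast
qed (rule Daugavet_not_in_tree_space)

end
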